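(* Let $T$ be an invertible block TBT-matrix, and let $u(\mu)=\begin{bmatrix}u_1(\mu)&u_2(\mu)\end{bmatrix}$, $E(\mu)$ and $N$ be associated with $T$ as in the context. Then $$u(\mu)=\vartheta(\mu)\begin{bmatrix}\mathcal L_2^*&0&\mathcal L_1^*&0\end{bmatrix}E(\mu)^{-1},$$ $$\vartheta(\mu):=-\mathrm i\Big(I_{m_3}+\mathcal L^*\Big(\prod_{i=1}^2(A_i^*-\mu_iI_m)^{-1}\Big)RN\Big),$$ for all $\mu=(\mu_1,\mu_2)\in\mathbb C^2$ with $\mu_1,\mu_2\neq-\mathrm i/2$ and $\det E(\mu)\neq0$. Here the two zero blocks have sizes $m_3\times m_2m_3$ and $m_3\times m_1m_3$, respectively.
   Context: Notation: $I_r$ is the $r\times r$ identity, $I=I_m$; $\otimes$ is the Kronecker product; ${}^*$ is the conjugate transpose; $\mathrm{col}[\dots]$ stacks blocks into a (block) column; $\mathbf 1_r$ is the $r\times1$ column of ones. Fix integers $m_1,m_2,m_3\ge2$ and put $m=m_1m_2m_3$. A block TBT-matrix is an $m\times m$ matrix $T=\{\mathcal T_{i-k}\}_{i,k=1}^{m_1}$, where $\mathcal T_r=\{t^{(r)}_{i-k}\}_{i,k=1}^{m_2}$ and the $t^{(r)}_s$ are complex $m_3\times m_3$ blocks. Let $\mathcal A_p=\{a_{j-\ell}\}_{j,\ell=1}^{m_p}$ with $a_r=0$ for $r<0$, $a_0=\mathrm i/2$, $a_r=\mathrm i$ for $r>0$, and $A_1=\mathcal A_1\otimes I_{m_2}\otimes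 I_{m_3}$, $A_2=I_{m_1}\otimes\mathcal A_2\otimes I_{m_3}$ (these commute). Let $\mathcal L=\mathbf 1_{m_1m_2}\otimes I_{m_3}$ and $\mathcal L_p=\mathbf 1_{m_p}\otimes I_{m_3}$ $(p=1,2)$. Define $M_{11}=\mathrm{col}[M_{11}^{(1)},\dots,M_{11}^{(m_1)}]$, $M_{11}^{(i)}=\tfrac12\mathcal T_0+\sum_{s=1}^{i-1}\mathcal T_s$; $M_{21}=\mathbf 1_{m_1}^*\otimes I_{m_2m_3}$; $M_{31}=M_{21}^*$; $M_{41}=[M_{41}^{(1)}\ \dots\ M_{41}^{(m_1)}]$, $M_{41}^{(k)}=\tfrac12\mathcal T_0+\sum_{s=1}^{k-1}\mathcal T_{-s}$; $M_{12}=\{M_{12}^{(i-k)}\}_{i,k=1}^{m_1}$, where $M_{12}^{(r)}$ is the block column with $i$-th block $\tfrac12t_0^{(r)}+\sum_{j=1}^{i-1}t_j^{(r)}$ $(1\le i\le m_2)$; $M_{22}=I_{m_1}\otimes\mathbf 1_{m_2}^*\otimes I_{m_3}$; $M_{32}=M_{22}^*$; $M_{42}=\{M_{42}^{(i-k)}\}_{i,k=1}^{m_1}$, where $M_{42}^{(r)}$ is the block row with $k$-th block $\tfrac12t_0^{(r)}+\sum_{\ell=1}^{k-1}t_{-\ell}^{(r)}$ $(1\le k\le m_2)$. For invertible $T$ and $p=1,2$ put $R=T^{-1}$, $\Pi_p=[M_{1p}\ M_{3p}]$, $\widehat\Pi_p=\begin{bmatrix}M_{2p} \\ M_{4p}\end{bmatrix}$,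 $\Gamma_p=R\Pi_p$. For $\{k,p\}=\{1,2\}$ define $$v_p(\mu)=\mathcal L^*\Big(\prod_{i=1}^2(A_i^*-\mu_iI)^{-1}\Big)\Gamma_p,\qquad u_p(\mu)=v_p(\mu)-\mathrm i\big(\mathbf 1_{m_k}^*(\mathcal A_k^*-\mu_kI_{m_k})^{-1}\otimes I_{m_3}\big)\begin{bmatrix}I_{m_km_3}&0\end{bmatrix},$$ with zero block square of order $m_km_3$. Define further $K_{11}$ = block column with $i$-th block $\tfrac12M_{42}^{(0)}+\sum_{j=1}^{i-1}M_{42}^{(j)}$ $(1\le i\le m_1)$; $K_{12}$ = block row with $k$-th block $\tfrac12M_{12}^{(0)}+\sum_{j=1}^{k-1}M_{12}^{(-j)}$ $(1\le k\le m_1)$; $N$ = block column with $i$-th block $\tfrac12M_{12}^{(0)}+\sum_{j=1}^{i-1}M_{12}^{(j)}$ $(1\le i\le m_1)$. The matrix function $E$ is $$E(\mu)=\begin{bmatrix}E_{11}(\mu_2)&E_{12} \\ E_{21}&E_{22}(\mu_1)\end{bmatrix},$$ $$E_{11}(\mu_2)=\begin{bmatrix}(\mathcal A_2^*-\mu_2I_{m_2})\otimes I_{m_3}&0 \\ 0&(\mathcal A_2^*-\mu_2I_{m_2})\otimes I_{m_3}\end{bmatrix},\quad E_{22}(\mu_1)=\begin{bmatrix}(\mathcal A_1^*-\mu_1I_{m_1})\otimes I_{m_3}&0 \\ 0&(\mathcal A_1^*-\mu_1I_{m_1})\otimes I_{m_3}\end{bmatrix},$$ $$E_{21}=-\mathrm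 i\left(\widehat\Pi_2\Gamma_1-\begin{bmatrix}0&0 \\ K_{11}&\mathcal L_1\mathcal L_2^*\end{bmatrix}\right),\qquad E_{12}=-\mathrm i\left(\widehat\Pi_1\Gamma_2-\begin{bmatrix}0&0 \\ K_{12}&\mathcal L_2\mathcal L_1^*\end{bmatrix}\right).$$ ($\det E(\mu)$ is a polynomial in $\mu_1,\mu_2$ that is not identically zero, so $E(\mu)^{-1}$ is a rational matrix function.) *)

theory Defs
  imports
    "Jordan_Normal_Form.Determinant"
    "Jordan_Normal_Form.Gauss_Jordan_Elimination"
    "Jordan_Normal_Form.Schur_Decomposition"
begin

text \<open>All matrix and block indices are 0-based. Thus a family of blocks
  indexed by \<open>i = 1, \<dots>, p\<close> on paper is indexed here by \<open>i = 0, \<dots>, p - 1\<close>, and a sum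
  over \<open>j = 1, \<dots>, i - 1\<close> on paper becomes a sum over \<open>j = 1, \<dots>, i\<close>. Differences of
  indices are unaffected by the shift; they are integers.\<close>

definition block_mat ::
  "nat \<Rightarrow> nat \<Rightarrow> nat \<Rightarrow> nat \<Rightarrow> (nat \<Rightarrow> nat \<Rightarrow> complex mat) \<Rightarrow> complex mat" where
  \<comment> \<open>\<open>p \<times> q\<close> blocks, each of size \<open>r \<times> c\<close>; the block in position \<open>(i, k)\<close> is \<open>F i k\<close>\<close>
  "block_mat p q r c F =
     mat (p * r) (q * c) (\<lambda>(i, j). F (i div r) (j div c) $$ (i mod r, j mod c))"

definition block_col :: "nat \<Rightarrow> nat \<Rightarrow> nat \<Rightarrow> (nat \<Rightarrow> complex mat) \<Rightarrow> complex mat" where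
  "block_col p r c F = block_mat p 1 r c (\<lambda>i _. F i)"

definition block_row :: "nat \<Rightarrow> nat \<Rightarrow> nat \<Rightarrow> (nat \<Rightarrow> complex mat) \<Rightarrow> complex mat" where
  "block_row q r c F = block_mat 1 q r c (\<lambda>_ k. F k)"

definition block_toeplitz :: "nat \<Rightarrow> nat \<Rightarrow> nat \<Rightarrow> (int \<Rightarrow> complex mat) \<Rightarrow> complex mat" where
  "block_toeplitz p r c X = block_mat p p r c (\<lambda>i k. X (int i - int k))"

definition kron :: "complex mat \<Rightarrow> complex mat \<Rightarrow> complex mat" (infixl \<open>\<otimes>\<^sub>K\<close> 75) where
  "A \<otimes>\<^sub>K B = block_mat (dim_row A) (dim_col A) (dim_row B) (dim_col B)
                (\<lambda>i k. A $$ (i, k) \<cdot>\<^sub>m B)"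

definition append_cols :: "complex mat \<Rightarrow> complex mat \<Rightarrow> complex mat" (infixr \<open>@\<^sub>c\<close> 65) where
  "A @\<^sub>c B = four_block_mat A B (0\<^sub>m 0 (dim_col A)) (0\<^sub>m 0 (dim_col B))"

definition half_sum :: "nat \<Rightarrow> nat \<Rightarrow> (int \<Rightarrow> complex mat) \<Rightarrow> nat \<Rightarrow> complex mat" where
  \<comment> \<open>the \<open>r \<times> c\<close> matrix \<open>X\<^sub>0/2 + X\<^sub>1 + \<dots> + X\<^sub>i\<close>\<close>
  "half_sum r c X i =
     mat r c (\<lambda>ab. 1/2 * X 0 $$ ab + (\<Sum>j = 1..i. X (int j) $$ ab))"

definition ones :: "nat \<Rightarrow> complex mat" where
  "ones r = mat r 1 (\<lambda>_. 1)"

definition minv :: "complex mat \<Rightarrow> complex mat" where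
  \<comment> \<open>the inverse; meaningful for invertible square matrices only\<close>
  "minv A = the (mat_inverse A)"

text \<open>A family \<open>t\<close> holds the blocks of a block TBT-matrix: \<open>t r s\<close> is the
  \<open>m3 \<times> m3\<close> block written with superscript \<open>(r)\<close> and subscript \<open>s\<close>, used only for
  \<open>\<bar>r\<bar> < m1\<close> and \<open>\<bar>s\<bar> < m2\<close>.\<close>

definition TBT_block :: "nat \<Rightarrow> nat \<Rightarrow> (int \<Rightarrow> int \<Rightarrow> complex mat) \<Rightarrow> int \<Rightarrow> complex mat" where
  "TBT_block m2 m3 t r = block_toeplitz m2 m3 m3 (t r)"

definition block_TBT ::
  "nat \<Rightarrow> nat \<Rightarrow> nat \<Rightarrow> (int \<Rightarrow> int \<Rightarrow> complex mat) \<Rightarrow> complex mat" where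
  "block_TBT m1 m2 m3 t = block_toeplitz m1 (m2 * m3) (m2 * m3) (TBT_block m2 m3 t)"

definition calA :: "nat \<Rightarrow> complex mat" where
  "calA n = mat n n (\<lambda>(j, l). if j < l then 0 else if j = l then \<i> / 2 else \<i>)"

definition A1 :: "nat \<Rightarrow> nat \<Rightarrow> nat \<Rightarrow> complex mat" where
  "A1 m1 m2 m3 = calA m1 \<otimes>\<^sub>K 1\<^sub>m m2 \<otimes>\<^sub>K 1\<^sub>m m3"

definition A2 :: "nat \<Rightarrow> nat \<Rightarrow> nat \<Rightarrow> complex mat" where
  "A2 m1 m2 m3 = 1\<^sub>m m1 \<otimes>\<^sub>K calA m2 \<otimes>\<^sub>K 1\<^sub>m m3"

text \<open>\<open>calL m1 m3\<close> and \<open>calL m2 m3\<close> are the matrices with index 1 and 2, and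
  \<open>calL (m1 * m2) m3\<close> is the one without index.\<close>

definition calL :: "nat \<Rightarrow> nat \<Rightarrow> complex mat" where
  "calL n m3 = ones n \<otimes>\<^sub>K 1\<^sub>m m3"

definition M11 :: "nat \<Rightarrow> nat \<Rightarrow> nat \<Rightarrow> (int \<Rightarrow> int \<Rightarrow> complex mat) \<Rightarrow> complex mat" where
  "M11 m1 m2 m3 t = block_col m1 (m2 * m3) (m2 * m3)
     (half_sum (m2 * m3) (m2 * m3) (TBT_block m2 m3 t))"

definition M21 :: "nat \<Rightarrow> nat \<Rightarrow> nat \<Rightarrow> complex mat" where
  "M21 m1 m2 m3 = mat_adjoint (ones m1) \<otimes>\<^sub>K 1\<^sub>m (m2 * m3)"

definition M31 :: "nat \<Rightarrow> nat \<Rightarrow> nat \<Rightarrow> complex mat" where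
  "M31 m1 m2 m3 = mat_adjoint (M21 m1 m2 m3)"

definition M41 :: "nat \<Rightarrow> nat \<Rightarrow> nat \<Rightarrow> (int \<Rightarrow> int \<Rightarrow> complex mat) \<Rightarrow> complex mat" where
  "M41 m1 m2 m3 t = block_row m1 (m2 * m3) (m2 * m3)
     (half_sum (m2 * m3) (m2 * m3) (\<lambda>s. TBT_block m2 m3 t (- s)))"

definition M12_block :: "nat \<Rightarrow> nat \<Rightarrow> (int \<Rightarrow> int \<Rightarrow> complex mat) \<Rightarrow> int \<Rightarrow> complex mat" where
  "M12_block m2 m3 t r = block_col m2 m3 m3 (half_sum m3 m3 (t r))"

definition M12 :: "nat \<Rightarrow> nat \<Rightarrow> nat \<Rightarrow> (int \<Rightarrow> int \<Rightarrow> complex mat) \<Rightarrow> complex mat" where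
  "M12 m1 m2 m3 t = block_toeplitz m1 (m2 * m3) m3 (M12_block m2 m3 t)"

definition M22 :: "nat \<Rightarrow> nat \<Rightarrow> nat \<Rightarrow> complex mat" where
  "M22 m1 m2 m3 = 1\<^sub>m m1 \<otimes>\<^sub>K mat_adjoint (ones m2) \<otimes>\<^sub>K 1\<^sub>m m3"

definition M32 :: "nat \<Rightarrow> nat \<Rightarrow> nat \<Rightarrow> complex mat" where
  "M32 m1 m2 m3 = mat_adjoint (M22 m1 m2 m3)"

definition M42_block :: "nat \<Rightarrow> nat \<Rightarrow> (int \<Rightarrow> int \<Rightarrow> complex mat) \<Rightarrow> int \<Rightarrow> complex mat" where
  "M42_block m2 m3 t r = block_row m2 m3 m3 (half_sum m3 m3 (\<lambda>s. t r (- s)))"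

definition M42 :: "nat \<Rightarrow> nat \<Rightarrow> nat \<Rightarrow> (int \<Rightarrow> int \<Rightarrow> complex mat) \<Rightarrow> complex mat" where
  "M42 m1 m2 m3 t = block_toeplitz m1 m3 (m2 * m3) (M42_block m2 m3 t)"

definition Rinv :: "nat \<Rightarrow> nat \<Rightarrow> nat \<Rightarrow> (int \<Rightarrow> int \<Rightarrow> complex mat) \<Rightarrow> complex mat" where
  "Rinv m1 m2 m3 t = minv (block_TBT m1 m2 m3 t)"

definition Pi1 :: "nat \<Rightarrow> nat \<Rightarrow> nat \<Rightarrow> (int \<Rightarrow> int \<Rightarrow> complex mat) \<Rightarrow> complex mat" where
  "Pi1 m1 m2 m3 t = M11 m1 m2 m3 t @\<^sub>c M31 m1 m2 m3"

definition Pi2 :: "nat \<Rightarrow> nat \<Rightarrow> nat \<Rightarrow> (int \<Rightarrow> int \<Rightarrow> complex mat) \<Rightarrow> complex mat" where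
  "Pi2 m1 m2 m3 t = M12 m1 m2 m3 t @\<^sub>c M32 m1 m2 m3"

definition Pi1_hat :: "nat \<Rightarrow> nat \<Rightarrow> nat \<Rightarrow> (int \<Rightarrow> int \<Rightarrow> complex mat) \<Rightarrow> complex mat" where
  "Pi1_hat m1 m2 m3 t = M21 m1 m2 m3 @\<^sub>r M41 m1 m2 m3 t"

definition Pi2_hat :: "nat \<Rightarrow> nat \<Rightarrow> nat \<Rightarrow> (int \<Rightarrow> int \<Rightarrow> complex mat) \<Rightarrow> complex mat" where
  "Pi2_hat m1 m2 m3 t = M22 m1 m2 m3 @\<^sub>r M42 m1 m2 m3 t"

definition Gamma1 :: "nat \<Rightarrow> nat \<Rightarrow> nat \<Rightarrow> (int \<Rightarrow> int \<Rightarrow> complex mat) \<Rightarrow> complex mat" where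
  "Gamma1 m1 m2 m3 t = Rinv m1 m2 m3 t * Pi1 m1 m2 m3 t"

definition Gamma2 :: "nat \<Rightarrow> nat \<Rightarrow> nat \<Rightarrow> (int \<Rightarrow> int \<Rightarrow> complex mat) \<Rightarrow> complex mat" where
  "Gamma2 m1 m2 m3 t = Rinv m1 m2 m3 t * Pi2 m1 m2 m3 t"

definition adj_shift :: "complex mat \<Rightarrow> complex \<Rightarrow> complex mat" where
  \<comment> \<open>\<open>X\<^sup>* - \<mu>I\<close> for square \<open>X\<close>\<close>
  "adj_shift X \<mu> = mat_adjoint X - \<mu> \<cdot>\<^sub>m 1\<^sub>m (dim_row X)"

definition resolvent_prod :: "nat \<Rightarrow> nat \<Rightarrow> nat \<Rightarrow> complex \<Rightarrow> complex \<Rightarrow> complex mat" where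
  \<comment> \<open>\<open>(A\<^sub>1\<^sup>* - \<mu>\<^sub>1I)\<^sup>-\<^sup>1(A\<^sub>2\<^sup>* - \<mu>\<^sub>2I)\<^sup>-\<^sup>1\<close>; the order is immaterial, as the factors commute\<close>
  "resolvent_prod m1 m2 m3 \<mu>1 \<mu>2 =
     minv (adj_shift (A1 m1 m2 m3) \<mu>1) * minv (adj_shift (A2 m1 m2 m3) \<mu>2)"

definition v1 :: "nat \<Rightarrow> nat \<Rightarrow> nat \<Rightarrow> (int \<Rightarrow> int \<Rightarrow> complex mat) \<Rightarrow> complex \<Rightarrow> complex \<Rightarrow> complex mat"
  where
  "v1 m1 m2 m3 t \<mu>1 \<mu>2 =
     mat_adjoint (calL (m1 * m2) m3) * resolvent_prod m1 m2 m3 \<mu>1 \<mu>2 * Gamma1 m1 m2 m3 t"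

definition v2 :: "nat \<Rightarrow> nat \<Rightarrow> nat \<Rightarrow> (int \<Rightarrow> int \<Rightarrow> complex mat) \<Rightarrow> complex \<Rightarrow> complex \<Rightarrow> complex mat"
  where
  "v2 m1 m2 m3 t \<mu>1 \<mu>2 =
     mat_adjoint (calL (m1 * m2) m3) * resolvent_prod m1 m2 m3 \<mu>1 \<mu>2 * Gamma2 m1 m2 m3 t"

definition u_corr :: "nat \<Rightarrow> nat \<Rightarrow> complex \<Rightarrow> complex mat" where
  \<comment> \<open>the term subtracted from \<open>v\<^sub>p\<close> to give \<open>u\<^sub>p\<close>, for \<open>n = m\<^sub>k\<close>, \<open>\<mu> = \<mu>\<^sub>k\<close>, \<open>k \<noteq> p\<close>\<close>
  "u_corr n m3 \<mu> =
     \<i> \<cdot>\<^sub>m (((mat_adjoint (ones n) * minv (adj_shift (calA n) \<mu>)) \<otimes>\<^sub>K 1\<^sub>m m3)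
           * (1\<^sub>m (n * m3) @\<^sub>c 0\<^sub>m (n * m3) (n * m3)))"

definition u1 :: "nat \<Rightarrow> nat \<Rightarrow> nat \<Rightarrow> (int \<Rightarrow> int \<Rightarrow> complex mat) \<Rightarrow> complex \<Rightarrow> complex \<Rightarrow> complex mat"
  where
  "u1 m1 m2 m3 t \<mu>1 \<mu>2 = v1 m1 m2 m3 t \<mu>1 \<mu>2 - u_corr m2 m3 \<mu>2"

definition u2 :: "nat \<Rightarrow> nat \<Rightarrow> nat \<Rightarrow> (int \<Rightarrow> int \<Rightarrow> complex mat) \<Rightarrow> complex \<Rightarrow> complex \<Rightarrow> complex mat"
  where
  "u2 m1 m2 m3 t \<mu>1 \<mu>2 = v2 m1 m2 m3 t \<mu>1 \<mu>2 - u_corr m1 m3 \<mu>1"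

definition u_fun :: "nat \<Rightarrow> nat \<Rightarrow> nat \<Rightarrow> (int \<Rightarrow> int \<Rightarrow> complex mat) \<Rightarrow> complex \<Rightarrow> complex \<Rightarrow> complex mat"
  where
  "u_fun m1 m2 m3 t \<mu>1 \<mu>2 = u1 m1 m2 m3 t \<mu>1 \<mu>2 @\<^sub>c u2 m1 m2 m3 t \<mu>1 \<mu>2"

definition K11 :: "nat \<Rightarrow> nat \<Rightarrow> nat \<Rightarrow> (int \<Rightarrow> int \<Rightarrow> complex mat) \<Rightarrow> complex mat" where
  "K11 m1 m2 m3 t = block_col m1 m3 (m2 * m3) (half_sum m3 (m2 * m3) (M42_block m2 m3 t))"

definition K12 :: "nat \<Rightarrow> nat \<Rightarrow> nat \<Rightarrow> (int \<Rightarrow> int \<Rightarrow> complex mat) \<Rightarrow> complex mat" where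
  "K12 m1 m2 m3 t =
     block_row m1 (m2 * m3) m3 (half_sum (m2 * m3) m3 (\<lambda>j. M12_block m2 m3 t (- j)))"

definition Nmat :: "nat \<Rightarrow> nat \<Rightarrow> nat \<Rightarrow> (int \<Rightarrow> int \<Rightarrow> complex mat) \<Rightarrow> complex mat" where
  "Nmat m1 m2 m3 t = block_col m1 (m2 * m3) m3 (half_sum (m2 * m3) m3 (M12_block m2 m3 t))"

definition E_diag :: "nat \<Rightarrow> nat \<Rightarrow> complex \<Rightarrow> complex mat" where
  \<comment> \<open>\<open>E\<^sub>1\<^sub>1\<close> for \<open>n = m2\<close>, \<open>\<mu> = \<mu>\<^sub>2\<close>, and \<open>E\<^sub>2\<^sub>2\<close> for \<open>n = m1\<close>, \<open>\<mu> = \<mu>\<^sub>1\<close>\<close>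
  "E_diag n m3 \<mu> =
     four_block_mat (adj_shift (calA n) \<mu> \<otimes>\<^sub>K 1\<^sub>m m3) (0\<^sub>m (n * m3) (n * m3))
                    (0\<^sub>m (n * m3) (n * m3)) (adj_shift (calA n) \<mu> \<otimes>\<^sub>K 1\<^sub>m m3)"

definition E21 :: "nat \<Rightarrow> nat \<Rightarrow> nat \<Rightarrow> (int \<Rightarrow> int \<Rightarrow> complex mat) \<Rightarrow> complex mat" where
  "E21 m1 m2 m3 t = (- \<i>) \<cdot>\<^sub>m (Pi2_hat m1 m2 m3 t * Gamma1 m1 m2 m3 t -
     four_block_mat (0\<^sub>m (m1 * m3) (m2 * m3)) (0\<^sub>m (m1 * m3) (m2 * m3))
                    (K11 m1 m2 m3 t) (calL m1 m3 * mat_adjoint (calL m2 m3)))"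

definition E12 :: "nat \<Rightarrow> nat \<Rightarrow> nat \<Rightarrow> (int \<Rightarrow> int \<Rightarrow> complex mat) \<Rightarrow> complex mat" where
  "E12 m1 m2 m3 t = (- \<i>) \<cdot>\<^sub>m (Pi1_hat m1 m2 m3 t * Gamma2 m1 m2 m3 t -
     four_block_mat (0\<^sub>m (m2 * m3) (m1 * m3)) (0\<^sub>m (m2 * m3) (m1 * m3))
                    (K12 m1 m2 m3 t) (calL m2 m3 * mat_adjoint (calL m1 m3)))"

definition E_fun :: "nat \<Rightarrow> nat \<Rightarrow> nat \<Rightarrow> (int \<Rightarrow> int \<Rightarrow> complex mat) \<Rightarrow> complex \<Rightarrow> complex \<Rightarrow> complex mat"
  where
  "E_fun m1 m2 m3 t \<mu>1 \<mu>2 =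
     four_block_mat (E_diag m2 m3 \<mu>2) (E12 m1 m2 m3 t)
                    (E21 m1 m2 m3 t) (E_diag m1 m3 \<mu>1)"

definition theta_fun :: "nat \<Rightarrow> nat \<Rightarrow> nat \<Rightarrow> (int \<Rightarrow> int \<Rightarrow> complex mat) \<Rightarrow> complex \<Rightarrow> complex \<Rightarrow> complex mat"
  where
  "theta_fun m1 m2 m3 t \<mu>1 \<mu>2 = (- \<i>) \<cdot>\<^sub>m (1\<^sub>m m3 +
     mat_adjoint (calL (m1 * m2) m3) * resolvent_prod m1 m2 m3 \<mu>1 \<mu>2
       * Rinv m1 m2 m3 t * Nmat m1 m2 m3 t)"

end

theory Submission
  imports Defs
begin

text \<open>It suffices to prove \<open>u E = \<theta> [L\<^sub>2\<^sup>*, 0, L\<^sub>1\<^sup>*, 0]\<close>, since \<open>E\<close> is invertible at the given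
point; this identity is checked separately on the two block columns of \<open>E\<close>. Everything
rests on displacement identities. The matrix \<open>\<A>\<close> is \<open>\<i>\<close> times summation, with half weight
on the diagonal, so commuting it past a Toeplitz matrix telescopes:
\<open>\<A>X - X\<A>\<^sup>*\<close> is \<open>\<i>\<close> times a block column of one-sided partial sums of \<open>X\<close> spread over all
columns, plus a block row of partial sums spread over all rows (\<open>toeplitz_displacement\<close>).

Applied at the outer or at the inner level of \<open>T\<close> this gives
\<open>A\<^sub>pT - TA\<^sub>p\<^sup>* = \<i>\<Pi>\<^sub>p\<Pi>h\<^sub>p\<close>, where \<open>\<Pi>h\<^sub>p\<close> is the hatted matrix. The columns of \<open>\<Pi>\<^sub>1\<close> and \<open>\<Pi>\<^sub>2\<close> are
themselves made of Toeplitz blocks in the other direction, and one more application gives,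
with \<open>D\<^sub>2\<close> the diagonal with two blocks \<open>\<A>\<^sub>2\<^sup>* \<otimes> I\<close>,
\<open>A\<^sub>2\<Pi>\<^sub>1 - \<Pi>\<^sub>1D\<^sub>2 = \<i>(\<Pi>\<^sub>2F + N[L\<^sub>2\<^sup>*, 0])\<close>, where \<open>F\<close> is the matrix with last row
\<open>[K\<^sub>1\<^sub>1, L\<^sub>1L\<^sub>2\<^sup>*]\<close> that is subtracted in \<open>E\<^sub>2\<^sub>1\<close>; similarly with the indices 1 and 2 exchanged. All
four identities survive the shift by \<open>\<mu>\<close>, because scalars commute with everything.

Put \<open>w = L\<^sup>*(A\<^sub>1\<^sup>* - \<mu>\<^sub>1)\<^sup>-\<^sup>1(A\<^sub>2\<^sup>* - \<mu>\<^sub>2)\<^sup>-\<^sup>1\<close>, so that \<open>v\<^sub>p = wR\<Pi>\<^sub>p\<close>. In the first block column of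
\<open>uE\<close> the term \<open>-\<i>wR\<Pi>\<^sub>2\<Pi>h\<^sub>2R\<Pi>\<^sub>1\<close> equals \<open>-w(RA\<^sub>2 - A\<^sub>2\<^sup>*R)\<Pi>\<^sub>1\<close>; the part with \<open>A\<^sub>2\<^sup>* - \<mu>\<^sub>2\<close> is cancelled by
the correction \<open>u\<^sub>2 - v\<^sub>2\<close>, the part with \<open>A\<^sub>2 - \<mu>\<^sub>2\<close> combines with \<open>v\<^sub>1E\<^sub>1\<^sub>1\<close> to the second kind of
identity, and only \<open>-\<i>wRN[L\<^sub>2\<^sup>*, 0]\<close> is left. The correction \<open>u\<^sub>1 - v\<^sub>1\<close> supplies the missing
\<open>-\<i>[L\<^sub>2\<^sup>*, 0]\<close>. This cancellation uses nothing about Toeplitz matrices and is isolated in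
\<open>resolvent_coupling\<close>; the second block column is another instance of it.\<close>

section \<open>Entries of products, adjoints and inverses\<close>

lemma index_mult_mat_sum:
  assumes "A \<in> carrier_mat n k" "B \<in> carrier_mat k m" "i < n" "j < m"
  shows "(A * B) $$ (i, j) = (\<Sum>l<k. A $$ (i, l) * B $$ (l, j))"
  using assms by (simp add: scalar_prod_def atLeast0LessThan)

lemma carrier_mat_adjoint [simp, intro]:
  "A \<in> carrier_mat n m \<Longrightarrow> mat_adjoint A \<in> carrier_mat m n"
  by (auto simp: mat_adjoint_def)

lemma dim_mat_adjoint [simp]:
  "dim_row (mat_adjoint A) = dim_col A" "dim_col (mat_adjoint A) = dim_row A"
  by (auto simp: mat_adjoint_def)

lemma index_mat_adjoint [simp]:
  fixes A :: "complex mat"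
  assumes "i < dim_col A" "j < dim_row A"
  shows "mat_adjoint A $$ (i, j) = cnj (A $$ (j, i))"
  using assms by (simp add: mat_adjoint_def mat_of_rows_def)

lemma minv_det_nonzero:
  assumes A: "A \<in> carrier_mat n n" and d: "det A \<noteq> 0"
  shows "minv A \<in> carrier_mat n n" "A * minv A = 1\<^sub>m n" "minv A * A = 1\<^sub>m n"
proof -
  have "mat_inverse A \<noteq> None"
    using mat_inverse(1)[OF A, of "()"] det_non_zero_imp_unit[OF A d, of "()"] by blast
  then obtain B where B: "mat_inverse A = Some B" by blast
  with mat_inverse(2)[OF A B] show "minv A \<in> carrier_mat n n" "A * minv A = 1\<^sub>m n" 
    "minv A * A = 1\<^sub>m n"
    by (auto simp: minv_def)
qed

lemma minv_invertible:
  assumes A: "A \<in> carrier_mat n n" and inv: "invertible_mat A"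
  shows "minv A \<in> carrier_mat n n" "A * minv A = 1\<^sub>m n" "minv A * A = 1\<^sub>m n"
proof -
  obtain B where B: "A * B = 1\<^sub>m n" "B * A = 1\<^sub>m (dim_row B)"
    using inv A by (auto simp: invertible_mat_def inverts_mat_def)
  have "dim_col B = n" using arg_cong[OF B(1), of dim_col] by simp
  moreover have "dim_row B = n" using arg_cong[OF B(2), of dim_col] A by simp
  ultimately have "B \<in> carrier_mat n n" by blast
  then have "det A * det B = 1" using det_mult[OF A, of B] B(1) by simp
  then have "det A \<noteq> 0" by auto
  then show "minv A \<in> carrier_mat n n" "A * minv A = 1\<^sub>m n" "minv A * A = 1\<^sub>m n"
    using minv_det_nonzero[OF A] by auto
qed

lemma minv_unique:
  assumes A: "A \<in> carrier_mat n n" and B: "B \<in> carrier_mat n n" and AB: "A * B = 1\<^sub>m n"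
  shows "minv A = B"
proof -
  have "det A * det B = 1" using det_mult[OF A B] AB by simp
  then have "det A \<noteq> 0" by auto
  note m = minv_det_nonzero[OF A this]
  have "minv A = minv A * (A * B)" using m AB by simp
  also have "\<dots> = B" using assoc_mult_mat[OF m(1) A B] m B by simp
  finally show ?thesis .
qed

section \<open>Uniform block matrices and Kronecker products\<close>

lemma carrier_block_mat [simp, intro]: "block_mat p q r c F \<in> carrier_mat (p * r) (q * c)"
  by (simp add: block_mat_def)

lemma block_index_less: "i < p \<Longrightarrow> a < r \<Longrightarrow> i * r + a < p * (r :: nat)"
  using mult_le_mono1[of "Suc i" p r] by simp

lemma index_block_mat [simp]:
  "i < p \<Longrightarrow> a < r \<Longrightarrow> k < q \<Longrightarrow> b < c \<Longrightarrow>
    block_mat p q r c F $$ (i * r + a, k * c + b) = F i k $$ (a, b)"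
  by (simp add: block_mat_def block_index_less)

text \<open>Comparing matrices at indices of the form \<open>i * r + a\<close> keeps block index and inner index apart, so
that the \<open>div\<close> and \<open>mod\<close> by the block size disappear.\<close>

lemma eq_block_matI:
  assumes A: "A \<in> carrier_mat (p * r) (q * c)" and B: "B \<in> carrier_mat (p * r) (q * c)"
    and "\<And>i a k b. i < p \<Longrightarrow> a < r \<Longrightarrow> k < q \<Longrightarrow> b < c \<Longrightarrow>
      A $$ (i * r + a, k * c + b) = B $$ (i * r + a, k * c + b)"
  shows "A = B"
proof (rule eq_matI)
  fix x y assume "x < dim_row B" "y < dim_col B"
  then have x: "x < p * r" and y: "y < q * c" using B by auto
  then have "0 < r" "0 < c" by (auto intro: Nat.gr0I)
  then have "x div r < p" "x mod r < r" "y div c < q" "y mod c < c"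
    using x y by (auto simp: less_mult_imp_div_less)
  from assms(3)[OF this] show "A $$ (x, y) = B $$ (x, y)" by simp
qed (use A B in auto)

lemma sum_blocks:
  "(\<Sum>x<q * c. f x) = (\<Sum>l<q. \<Sum>b<c. f (l * c + b))" for f :: "nat \<Rightarrow> 'a::comm_monoid_add"
proof -
  have "(\<Sum>x<q * c. f x) = (\<Sum>l<q. sum f {l * c..<l * c + c})"
    by (rule sum.nat_group[symmetric])
  moreover have "sum f {l * c..<l * c + c} = (\<Sum>b<c. f (l * c + b))" for l
    using sum.shift_bounds_nat_ivl[of f 0 "l * c" c] by (simp add: atLeast0LessThan add.commute)
  ultimately show ?thesis by simp
qed

lemma index_mult_blocks:
  assumes "A \<in> carrier_mat n (q * c)" "B \<in> carrier_mat (q * c) m" "i < n" "j < m"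
  shows "(A * B) $$ (i, j) = (\<Sum>l<q. \<Sum>b<c. A $$ (i, l * c + b) * B $$ (l * c + b, j))"
  by (simp add: index_mult_mat_sum[OF assms] sum_blocks)

lemma carrier_kron [simp, intro]:
  "A \<in> carrier_mat p q \<Longrightarrow> B \<in> carrier_mat r c \<Longrightarrow> A \<otimes>\<^sub>K B \<in> carrier_mat (p * r) (q * c)"
  by (auto simp: kron_def)

lemma dim_kron [simp]:
  "dim_row (A \<otimes>\<^sub>K B) = dim_row A * dim_row B" "dim_col (A \<otimes>\<^sub>K B) = dim_col A * dim_col B"
  by (simp_all add: kron_def block_mat_def)

lemma index_kron:
  "A \<in> carrier_mat p q \<Longrightarrow> B \<in> carrier_mat r c \<Longrightarrow> i < p \<Longrightarrow> a < r \<Longrightarrow> k < q \<Longrightarrow> b < c \<Longrightarrow>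
    (A \<otimes>\<^sub>K B) $$ (i * r + a, k * c + b) = A $$ (i, k) * B $$ (a, b)"
  by (auto simp: kron_def)

lemma kron_assoc: "A \<otimes>\<^sub>K B \<otimes>\<^sub>K C = A \<otimes>\<^sub>K (B \<otimes>\<^sub>K C)"
proof -
  obtain p q r c s d where A: "A \<in> carrier_mat p q" and B: "B \<in> carrier_mat r c"
    and C: "C \<in> carrier_mat s d" by blast
  note AB = carrier_kron[OF A B] and BC = carrier_kron[OF B C]
  show ?thesis
  proof (rule eq_block_matI[of _ p "r * s" q "c * d"])
    fix i a k b assume ik: "i < p" "a < r * s" "k < q" "b < c * d"
    define a1 a2 b1 b2 where d: "a1 = a div s" "a2 = a mod s" "b1 = b div d" "b2 = b mod d"
    have "0 < s" "0 < d" using ik by (auto intro: Nat.gr0I)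
    then have l: "a1 < r" "a2 < s" "b1 < c" "b2 < d" using ik
      by (auto simp: d less_mult_imp_div_less)
    have ab: "a = a1 * s + a2" "b = b1 * d + b2" by (simp_all add: d)
    have "(A \<otimes>\<^sub>K B \<otimes>\<^sub>K C) $$ ((i * r + a1) * s + a2, (k * c + b1) * d + b2)
      = (A $$ (i, k) * B $$ (a1, b1)) * C $$ (a2, b2)"
      using ik l by (simp add: index_kron[OF AB C] index_kron[OF A B] block_index_less)
    moreover have "(A \<otimes>\<^sub>K (B \<otimes>\<^sub>K C)) $$ (i * (r * s) + a, k * (c * d) + b)
      = A $$ (i, k) * (B $$ (a1, b1) * C $$ (a2, b2))"
      using ik l by (simp add: index_kron[OF A BC] index_kron[OF B C] ab)
    moreover have "(i * r + a1) * s + a2 = i * (r * s) + a" "(k * c + b1) * d + b2 = k * (c * d) + b"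
      by (simp_all add: ab algebra_simps)
    ultimately show "(A \<otimes>\<^sub>K B \<otimes>\<^sub>K C) $$ (i * (r * s) + a, k * (c * d) + b)
      = (A \<otimes>\<^sub>K (B \<otimes>\<^sub>K C)) $$ (i * (r * s) + a, k * (c * d) + b)"
      by simp
  qed (use carrier_kron[OF AB C] carrier_kron[OF A BC] in \<open>simp_all add: mult.assoc\<close>)
qed

lemma kron_mult:
  assumes A: "A \<in> carrier_mat p q" and B: "B \<in> carrier_mat r c"
    and C: "C \<in> carrier_mat q s" and D: "D \<in> carrier_mat c d"
  shows "(A \<otimes>\<^sub>K B) * (C \<otimes>\<^sub>K D) = (A * C) \<otimes>\<^sub>K (B * D)"
proof (rule eq_block_matI[of _ p r s d])
  fix i a k b assume l: "i < p" "a < r" "k < s" "b < d"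
  have "((A \<otimes>\<^sub>K B) * (C \<otimes>\<^sub>K D)) $$ (i * r + a, k * d + b)
    = (\<Sum>l<q. \<Sum>e<c. (A $$ (i, l) * B $$ (a, e)) * (C $$ (l, k) * D $$ (e, b)))"
    using l by (subst index_mult_blocks[OF carrier_kron[OF A B] carrier_kron[OF C D]])
      (simp_all add: block_index_less index_kron[OF A B] index_kron[OF C D])
  also have "\<dots> = (\<Sum>l<q. \<Sum>e<c. (A $$ (i, l) * C $$ (l, k)) * (B $$ (a, e) * D $$ (e, b)))"
    by (simp only: mult.assoc mult.left_commute)
  also have "\<dots> = ((A * C) \<otimes>\<^sub>K (B * D)) $$ (i * r + a, k * d + b)"
    using l by (simp add: index_kron[OF mult_carrier_mat[OF A C] mult_carrier_mat[OF B D]]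
      index_mult_mat_sum[OF A C] index_mult_mat_sum[OF B D] sum_product del: index_mult_mat)
  finally show "((A \<otimes>\<^sub>K B) * (C \<otimes>\<^sub>K D)) $$ (i * r + a, k * d + b)
    = ((A * C) \<otimes>\<^sub>K (B * D)) $$ (i * r + a, k * d + b)" .
qed (use A B C D mult_carrier_mat[OF carrier_kron[OF A B] carrier_kron[OF C D]] in auto)

lemma kron_one_one: "1\<^sub>m p \<otimes>\<^sub>K 1\<^sub>m r = (1\<^sub>m (p * r) :: complex mat)"
proof (rule eq_block_matI[of _ p r p r])
  fix i a k b assume l: "i < p" "a < r" "k < p" "b < r"
  have "i * r + a = k * r + b \<longleftrightarrow> i = k \<and> a = b"
  proof -
    have "(i * r + a) div r = i" "(k * r + b) div r = k" using l by auto
    then show ?thesis by auto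
  qed
  then show "(1\<^sub>m p \<otimes>\<^sub>K 1\<^sub>m r) $$ (i * r + a, k * r + b) = (1\<^sub>m (p * r) :: complex mat) $$ (i * r + a, k * r + b)"
    using l by (subst index_kron[of _ p p _ r r]) (auto simp: block_index_less)
qed auto

lemma mat_adjoint_kron: "mat_adjoint (A \<otimes>\<^sub>K B) = mat_adjoint A \<otimes>\<^sub>K mat_adjoint B"
proof -
  obtain p q r c where A: "A \<in> carrier_mat p q" and B: "B \<in> carrier_mat r c" by blast
  show ?thesis
  proof (rule eq_block_matI[of _ q c p r])
    fix i a k b assume l: "i < q" "a < c" "k < p" "b < r"
    have "mat_adjoint (A \<otimes>\<^sub>K B) $$ (i * c + a, k * r + b) = cnj ((A \<otimes>\<^sub>K B) $$ (k * r + b, i * c + a))"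
      using l carrier_kron[OF A B] by (intro index_mat_adjoint) (auto simp: block_index_less)
    then show "mat_adjoint (A \<otimes>\<^sub>K B) $$ (i * c + a, k * r + b)
      = (mat_adjoint A \<otimes>\<^sub>K mat_adjoint B) $$ (i * c + a, k * r + b)"
      using l A B
      by (simp add: index_kron[OF A B] index_kron[OF carrier_mat_adjoint[OF A] carrier_mat_adjoint[OF B]])
  qed (use A B carrier_kron[OF A B] in auto)
qed

lemma mat_adjoint_one [simp]: "mat_adjoint (1\<^sub>m n) = (1\<^sub>m n :: complex mat)"
  by (rule eq_matI) auto

lemma mat_adjoint_adjoint [simp]: "mat_adjoint (mat_adjoint A) = (A :: complex mat)"
  by (rule eq_matI) auto

lemma kron_minus_left:
  assumes "A \<in> carrier_mat p q" "B \<in> carrier_mat p q" "C \<in> carrier_mat r c"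
  shows "(A - B) \<otimes>\<^sub>K C = A \<otimes>\<^sub>K C - B \<otimes>\<^sub>K C"
proof (rule eq_block_matI[of _ p r q c])
  fix i a k b assume l: "i < p" "a < r" "k < q" "b < c"
  have d: "i * r + a < p * r" "k * c + b < q * c" using l by (simp_all add: block_index_less)
  show "((A - B) \<otimes>\<^sub>K C) $$ (i * r + a, k * c + b) = (A \<otimes>\<^sub>K C - B \<otimes>\<^sub>K C) $$ (i * r + a, k * c + b)"
    using l d assms
    by (simp add: index_kron[OF minus_carrier_mat[OF assms(2)] assms(3)] index_kron[OF assms(1,3)] index_kron[OF assms(2,3)]
        left_diff_distrib right_diff_distrib)
qed (use assms in \<open>simp_all add: minus_carrier_mat\<close>)

lemma kron_minus_right:
  assumes "A \<in> carrier_mat p q" "B \<in> carrier_mat r c" "C \<in> carrier_mat r c"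
  shows "A \<otimes>\<^sub>K (B - C) = A \<otimes>\<^sub>K B - A \<otimes>\<^sub>K C"
proof (rule eq_block_matI[of _ p r q c])
  fix i a k b assume l: "i < p" "a < r" "k < q" "b < c"
  have d: "i * r + a < p * r" "k * c + b < q * c" using l by (simp_all add: block_index_less)
  show "(A \<otimes>\<^sub>K (B - C)) $$ (i * r + a, k * c + b) = (A \<otimes>\<^sub>K B - A \<otimes>\<^sub>K C) $$ (i * r + a, k * c + b)"
    using l d assms
    by (simp add: index_kron[OF assms(1) minus_carrier_mat[OF assms(3)]] index_kron[OF assms(1,2)] index_kron[OF assms(1,3)]
        left_diff_distrib right_diff_distrib)
qed (use assms in \<open>simp_all add: minus_carrier_mat\<close>)

lemma kron_smult_left:
  assumes "A \<in> carrier_mat p q" "B \<in> carrier_mat r c"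
  shows "(x \<cdot>\<^sub>m A) \<otimes>\<^sub>K B = x \<cdot>\<^sub>m (A \<otimes>\<^sub>K B)"
proof (rule eq_block_matI[of _ p r q c])
  fix i a k b assume l: "i < p" "a < r" "k < q" "b < c"
  have d: "i * r + a < p * r" "k * c + b < q * c" using l by (simp_all add: block_index_less)
  show "((x \<cdot>\<^sub>m A) \<otimes>\<^sub>K B) $$ (i * r + a, k * c + b) = (x \<cdot>\<^sub>m (A \<otimes>\<^sub>K B)) $$ (i * r + a, k * c + b)"
    using l d assms
    by (simp add: index_kron[OF smult_carrier_mat[OF assms(1)] assms(2)] index_kron[OF assms(1,2)])
qed (use assms in \<open>simp_all add: minus_carrier_mat\<close>)

lemma kron_smult_right:
  assumes "A \<in> carrier_mat p q" "B \<in> carrier_mat r c"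
  shows "A \<otimes>\<^sub>K (x \<cdot>\<^sub>m B) = x \<cdot>\<^sub>m (A \<otimes>\<^sub>K B)"
proof (rule eq_block_matI[of _ p r q c])
  fix i a k b assume l: "i < p" "a < r" "k < q" "b < c"
  have d: "i * r + a < p * r" "k * c + b < q * c" using l by (simp_all add: block_index_less)
  show "(A \<otimes>\<^sub>K (x \<cdot>\<^sub>m B)) $$ (i * r + a, k * c + b) = (x \<cdot>\<^sub>m (A \<otimes>\<^sub>K B)) $$ (i * r + a, k * c + b)"
    using l d assms
    by (simp add: index_kron[OF assms(1) smult_carrier_mat[OF assms(2)]] index_kron[OF assms(1,2)])
qed (use assms in \<open>simp_all add: minus_carrier_mat\<close>)

text \<open>Multiplication by \<open>I \<otimes> Y\<close> acts on each block separately, and multiplication by \<open>A \<otimes> I\<close> forms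
scalar combinations of whole blocks. These are the only products of block matrices that occur, so
sums of matrices never have to be formed.\<close>

lemma kron_one_left_mult_block_mat:
  assumes Y: "Y \<in> carrier_mat r' r" and F: "\<And>i k. i < p \<Longrightarrow> k < q \<Longrightarrow> F i k \<in> carrier_mat r c"
  shows "(1\<^sub>m p \<otimes>\<^sub>K Y) * block_mat p q r c F = block_mat p q r' c (\<lambda>i k. Y * F i k)"
proof (rule eq_block_matI[of _ p r' q c])
  fix i a k b assume l: "i < p" "a < r'" "k < q" "b < c"
  have "((1\<^sub>m p \<otimes>\<^sub>K Y) * block_mat p q r c F) $$ (i * r' + a, k * c + b)
    = (\<Sum>l<p. \<Sum>e<r. (if i = l then Y $$ (a, e) * F l k $$ (e, b) else 0))"
    using l by (subst index_mult_blocks[OF carrier_kron[OF one_carrier_mat Y] carrier_block_mat])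
      (auto simp: block_index_less index_kron[OF one_carrier_mat Y] intro!: sum.cong)
  also have "\<dots> = (\<Sum>l<p. if i = l then (\<Sum>e<r. Y $$ (a, e) * F l k $$ (e, b)) else 0)"
    by (intro sum.cong) auto
  also have "\<dots> = (Y * F i k) $$ (a, b)"
    using l by (simp add: index_mult_mat_sum[OF Y F])
  finally show "((1\<^sub>m p \<otimes>\<^sub>K Y) * block_mat p q r c F) $$ (i * r' + a, k * c + b)
    = block_mat p q r' c (\<lambda>i k. Y * F i k) $$ (i * r' + a, k * c + b)"
    using l by simp
qed (use mult_carrier_mat[OF carrier_kron[OF one_carrier_mat Y] carrier_block_mat] in auto)

lemma block_mat_mult_kron_one_left:
  assumes Y: "Y \<in> carrier_mat c c'" and F: "\<And>i k. i < p \<Longrightarrow> k < q \<Longrightarrow> F i k \<in> carrier_mat r c"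
  shows "block_mat p q r c F * (1\<^sub>m q \<otimes>\<^sub>K Y) = block_mat p q r c' (\<lambda>i k. F i k * Y)"
proof (rule eq_block_matI[of _ p r q c'])
  fix i a k b assume l: "i < p" "a < r" "k < q" "b < c'"
  have "(block_mat p q r c F * (1\<^sub>m q \<otimes>\<^sub>K Y)) $$ (i * r + a, k * c' + b)
    = (\<Sum>l<q. \<Sum>e<c. (if l = k then F i l $$ (a, e) * Y $$ (e, b) else 0))"
    using l by (subst index_mult_blocks[OF carrier_block_mat carrier_kron[OF one_carrier_mat Y]])
      (auto simp: block_index_less index_kron[OF one_carrier_mat Y] intro!: sum.cong)
  also have "\<dots> = (\<Sum>l<q. if l = k then (\<Sum>e<c. F i l $$ (a, e) * Y $$ (e, b)) else 0)"
    by (intro sum.cong) auto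
  also have "\<dots> = (F i k * Y) $$ (a, b)"
    using l by (simp add: index_mult_mat_sum[OF F Y])
  finally show "(block_mat p q r c F * (1\<^sub>m q \<otimes>\<^sub>K Y)) $$ (i * r + a, k * c' + b)
    = block_mat p q r c' (\<lambda>i k. F i k * Y) $$ (i * r + a, k * c' + b)"
    using l by simp
qed (use mult_carrier_mat[OF carrier_block_mat carrier_kron[OF one_carrier_mat Y]] in auto)

lemma index_kron_one_right_mult_block_mat:
  assumes A: "A \<in> carrier_mat p q" and l: "i < p" "a < r" "k < s" "b < c"
  shows "((A \<otimes>\<^sub>K 1\<^sub>m r) * block_mat q s r c F) $$ (i * r + a, k * c + b)
    = (\<Sum>l<q. A $$ (i, l) * F l k $$ (a, b))"
proof -
  have "((A \<otimes>\<^sub>K 1\<^sub>m r) * block_mat q s r c F) $$ (i * r + a, k * c + b)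
    = (\<Sum>l<q. \<Sum>e<r. if a = e then A $$ (i, l) * F l k $$ (e, b) else 0)"
    using l by (subst index_mult_blocks[OF carrier_kron[OF A one_carrier_mat] carrier_block_mat],
        simp add: block_index_less, simp add: block_index_less)
      (rule sum.cong[OF refl], rule sum.cong[OF refl],
        auto simp: block_index_less index_kron[OF A one_carrier_mat])
  then show ?thesis using l by simp
qed

lemma index_block_mat_mult_kron_one_right:
  assumes A: "A \<in> carrier_mat q s" and l: "i < p" "a < r" "k < s" "b < c"
  shows "(block_mat p q r c F * (A \<otimes>\<^sub>K 1\<^sub>m c)) $$ (i * r + a, k * c + b)
    = (\<Sum>l<q. F i l $$ (a, b) * A $$ (l, k))"
proof -
  have "(block_mat p q r c F * (A \<otimes>\<^sub>K 1\<^sub>m c)) $$ (i * r + a, k * c + b)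
    = (\<Sum>l<q. \<Sum>e<c. if e = b then F i l $$ (a, e) * A $$ (l, k) else 0)"
    using l by (subst index_mult_blocks[OF carrier_block_mat carrier_kron[OF A one_carrier_mat]],
        simp add: block_index_less, simp add: block_index_less)
      (rule sum.cong[OF refl], rule sum.cong[OF refl],
        auto simp: block_index_less index_kron[OF A one_carrier_mat])
  then show ?thesis using l by simp
qed

lemma kron_one_left: "1\<^sub>m 1 \<otimes>\<^sub>K B = B"
proof -
  obtain r c where B: "B \<in> carrier_mat r c" by blast
  show ?thesis
  proof (rule eq_matI)
    fix i j assume l: "i < dim_row B" "j < dim_col B"
    then have "(1\<^sub>m 1 \<otimes>\<^sub>K B) $$ (0 * r + i, 0 * c + j) = B $$ (i, j)"
      using B by (subst index_kron[OF one_carrier_mat B]) auto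
    then show "(1\<^sub>m 1 \<otimes>\<^sub>K B) $$ (i, j) = B $$ (i, j)" by simp
  qed auto
qed

section \<open>Displacement of block Toeplitz matrices\<close>

lemma sum_shifted_prefix:
  fixes f :: "int \<Rightarrow> complex"
  shows "(\<Sum>l<i. f (int l - int (Suc k))) + f (int i - int (Suc k))
    = f (- int (Suc k)) + (\<Sum>l<i. f (int l - int k))"
  by (induction i) (simp_all add: algebra_simps)

text \<open>The telescoping behind all displacement identities. The two sums on the left run along column \<open>k\<close>
above row \<open>i\<close> and along row \<open>i\<close> left of column \<open>k\<close>; together with the entry at \<open>(i, k)\<close> they meet
every diagonal from \<open>-k\<close> to \<open>i\<close> exactly once.\<close>

lemma sum_toeplitz_prefixes:
  fixes f :: "int \<Rightarrow> complex"
  shows "f (int i - int k) + (\<Sum>l<i. f (int l - int k)) + (\<Sum>l<k. f (int i - int l))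
    = f 0 + (\<Sum>j=1..i. f (int j)) + (\<Sum>j=1..k. f (- int j))"
proof (induction k)
  case 0
  show ?case by (induction i) (simp_all add: algebra_simps)
next
  case (Suc k)
  then show ?case using sum_shifted_prefix[of f k i] by (simp add: algebra_simps)
qed

lemma carrier_calA [simp, intro]: "calA p \<in> carrier_mat p p"
  by (simp add: calA_def)

lemma carrier_ones [simp, intro]: "ones p \<in> carrier_mat p 1"
  by (simp add: ones_def)

lemma dim_calA [simp]: "dim_row (calA p) = p" "dim_col (calA p) = p"
  by (simp_all add: calA_def)

lemma dim_ones [simp]: "dim_row (ones p) = p" "dim_col (ones p) = 1"
  by (simp_all add: ones_def)

text \<open>The action of \<open>calA\<close> from the left, and of its adjoint from the right, as a partial sum in which
the last term has weight one half.\<close>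

lemma sum_calA:
  assumes "i < p"
  shows "(\<Sum>l<p. calA p $$ (i, l) * g l) = \<i> * (1/2 * g i + (\<Sum>l<i. g l))"
proof -
  have "(\<Sum>l<p. calA p $$ (i, l) * g l)
    = (\<Sum>l<p. (if l = i then \<i> / 2 * g l else 0) + (if l < i then \<i> * g l else 0))"
    using assms by (intro sum.cong) (auto simp: calA_def)
  also have "\<dots> = \<i> / 2 * g i + (\<Sum>l<i. \<i> * g l)"
    using assms by (simp add: sum.distrib sum.inter_filter[symmetric])
      (intro sum.cong, auto)
  finally show ?thesis by (simp add: algebra_simps sum_distrib_left)
qed

lemma sum_calA_adjoint:
  assumes "k < p"
  shows "(\<Sum>l<p. g l * mat_adjoint (calA p) $$ (l, k)) = - \<i> * (1/2 * g k + (\<Sum>l<k. g l))"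
proof -
  have "(\<Sum>l<p. g l * mat_adjoint (calA p) $$ (l, k)) = (\<Sum>l<p. cnj (calA p $$ (k, l) * cnj (g l)))"
    using assms by (intro sum.cong) (auto simp: calA_def)
  also have "\<dots> = cnj (\<Sum>l<p. calA p $$ (k, l) * cnj (g l))"
    by simp
  also have "\<dots> = - \<i> * (1/2 * g k + (\<Sum>l<k. g l))"
    by (simp add: sum_calA[OF assms])
  finally show ?thesis .
qed

lemma calA_minus_adjoint:
  "calA p - mat_adjoint (calA p) = \<i> \<cdot>\<^sub>m (ones p * mat_adjoint (ones p))"
  by (rule eq_matI) (auto simp: calA_def ones_def scalar_prod_def)

lemma carrier_block_toeplitz [simp, intro]:
  "block_toeplitz p r c X \<in> carrier_mat (p * r) (p * c)"
  by (simp add: block_toeplitz_def)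

lemma carrier_block_col [simp, intro]: "block_col p r c F \<in> carrier_mat (p * r) c"
  using carrier_block_mat[of p 1 r c] by (simp add: block_col_def)

lemma carrier_block_row [simp, intro]: "block_row q r c F \<in> carrier_mat r (q * c)"
  using carrier_block_mat[of 1 q r c] by (simp add: block_row_def)

lemma carrier_half_sum [simp, intro]: "half_sum r c X i \<in> carrier_mat r c"
  by (simp add: half_sum_def)

lemma index_half_sum [simp]:
  "a < r \<Longrightarrow> b < c \<Longrightarrow>
    half_sum r c X i $$ (a, b) = 1/2 * X 0 $$ (a, b) + (\<Sum>j=1..i. X (int j) $$ (a, b))"
  by (simp add: half_sum_def)

text \<open>The two halves of the entry at \<open>(i, k)\<close>, one from each product on the left, add up to the full
entry that \<open>sum_toeplitz_prefixes\<close> needs; the sign of the second product is reversed because the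
adjoint conjugates \<open>\<i>\<close>. Position \<open>(a, b)\<close> inside the blocks is a parameter throughout: the identity
is the scalar one, applied to the sequence of entries of the blocks at that position.\<close>

lemma toeplitz_displacement:
  "(calA p \<otimes>\<^sub>K 1\<^sub>m r) * block_toeplitz p r c X
     - block_toeplitz p r c X * (mat_adjoint (calA p) \<otimes>\<^sub>K 1\<^sub>m c)
   = \<i> \<cdot>\<^sub>m (block_col p r c (half_sum r c X) * (mat_adjoint (ones p) \<otimes>\<^sub>K 1\<^sub>m c)
     + (ones p \<otimes>\<^sub>K 1\<^sub>m r) * block_row p r c (half_sum r c (\<lambda>j. X (- j))))"
  (is "?A * ?X - ?X * ?B = \<i> \<cdot>\<^sub>m (?C * ?L + ?M * ?R)")
proof (rule eq_block_matI[of _ p r p c])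
  have A: "?A \<in> carrier_mat (p * r) (p * r)" and B: "?B \<in> carrier_mat (p * c) (p * c)"
    and L: "?L \<in> carrier_mat c (p * c)" and M: "?M \<in> carrier_mat (p * r) r"
    using carrier_kron[OF carrier_mat_adjoint[OF carrier_ones[of p]] one_carrier_mat[of c]]
      carrier_kron[OF carrier_ones[of p] one_carrier_mat[of r]]
    by auto
  note c = mult_carrier_mat[OF A carrier_block_toeplitz[of p r c X]]
    mult_carrier_mat[OF carrier_block_toeplitz[of p r c X] B]
    mult_carrier_mat[OF carrier_block_col[of p r c "half_sum r c X"] L]
    mult_carrier_mat[OF M carrier_block_row[of p r c "half_sum r c (\<lambda>j. X (- j))"]]
  show "?A * ?X - ?X * ?B \<in> carrier_mat (p * r) (p * c)"
    "\<i> \<cdot>\<^sub>m (?C * ?L + ?M * ?R) \<in> carrier_mat (p * r) (p * c)"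
    using c by (auto intro: minus_carrier_mat)
  fix i a k b assume l: "i < p" "a < r" "k < p" "b < c"
  have d: "i * r + a < p * r" "k * c + b < p * c" using l by (simp_all add: block_index_less)
  let ?f = "\<lambda>s. X s $$ (a, b)"
  have AX: "(?A * ?X) $$ (i * r + a, k * c + b)
    = \<i> * (1/2 * ?f (int i - int k) + (\<Sum>l<i. ?f (int l - int k)))"
    unfolding block_toeplitz_def using l
    by (simp only: index_kron_one_right_mult_block_mat[OF carrier_calA] sum_calA)
  have XB: "(?X * ?B) $$ (i * r + a, k * c + b)
    = - \<i> * (1/2 * ?f (int i - int k) + (\<Sum>l<k. ?f (int i - int l)))"
    unfolding block_toeplitz_def using l
    by (simp only: index_block_mat_mult_kron_one_right[OF carrier_mat_adjoint[OF carrier_calA]]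
        sum_calA_adjoint)
  have CL: "(?C * ?L) $$ (i * r + a, k * c + b) = 1/2 * ?f 0 + (\<Sum>j=1..i. ?f (int j))"
    unfolding block_col_def using l
    by (subst index_block_mat_mult_kron_one_right[OF carrier_mat_adjoint[OF carrier_ones]])
      (auto simp: ones_def)
  have MR: "(?M * ?R) $$ (i * r + a, k * c + b) = 1/2 * ?f 0 + (\<Sum>j=1..k. ?f (- int j))"
    unfolding block_row_def using l
    by (subst index_kron_one_right_mult_block_mat[OF carrier_ones])
      (auto simp: ones_def)
  have "(?A * ?X - ?X * ?B) $$ (i * r + a, k * c + b)
    = (?A * ?X) $$ (i * r + a, k * c + b) - (?X * ?B) $$ (i * r + a, k * c + b)"
    using d c by (intro index_minus_mat) auto
  also have "\<dots> = \<i> * (?f (int i - int k) + (\<Sum>l<i. ?f (int l - int k)) + (\<Sum>l<k. ?f (int i - int l)))"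
    unfolding AX XB by (simp add: algebra_simps)
  also have "\<dots> = \<i> * ((?C * ?L) $$ (i * r + a, k * c + b) + (?M * ?R) $$ (i * r + a, k * c + b))"
    unfolding sum_toeplitz_prefixes[of ?f i k] CL MR by (simp add: algebra_simps)
  also have "\<dots> = (\<i> \<cdot>\<^sub>m (?C * ?L + ?M * ?R)) $$ (i * r + a, k * c + b)"
    using d carrier_matD[OF c(3)] carrier_matD[OF c(4)]
    by (simp del: index_mult_mat dim_kron)
  finally show "(?A * ?X - ?X * ?B) $$ (i * r + a, k * c + b)
    = (\<i> \<cdot>\<^sub>m (?C * ?L + ?M * ?R)) $$ (i * r + a, k * c + b)" .
qed

text \<open>A displacement identity valid for every block of a block matrix is one for the whole matrix. This
lifts the identity at the inner level of a block TBT-matrix to the matrices built from its blocks.\<close>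

lemma block_mat_displacement:
  assumes U: "U \<in> carrier_mat r r" and V: "V \<in> carrier_mat c c"
    and W: "W \<in> carrier_mat d c" and Z: "Z \<in> carrier_mat r e"
    and F: "\<And>i k. i < p \<Longrightarrow> k < q \<Longrightarrow> F i k \<in> carrier_mat r c"
    and Y: "\<And>i k. i < p \<Longrightarrow> k < q \<Longrightarrow> Y i k \<in> carrier_mat r d"
    and S: "\<And>i k. i < p \<Longrightarrow> k < q \<Longrightarrow> S i k \<in> carrier_mat e c"
    and eq: "\<And>i k. i < p \<Longrightarrow> k < q \<Longrightarrow> U * F i k - F i k * V = x \<cdot>\<^sub>m (Y i k * W + Z * S i k)"
  shows "(1\<^sub>m p \<otimes>\<^sub>K U) * block_mat p q r c F - block_mat p q r c F * (1\<^sub>m q \<otimes>\<^sub>K V)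
    = x \<cdot>\<^sub>m (block_mat p q r d Y * (1\<^sub>m q \<otimes>\<^sub>K W) + (1\<^sub>m p \<otimes>\<^sub>K Z) * block_mat p q e c S)"
proof -
  have "block_mat p q r c (\<lambda>i k. U * F i k) - block_mat p q r c (\<lambda>i k. F i k * V)
    = x \<cdot>\<^sub>m (block_mat p q r c (\<lambda>i k. Y i k * W) + block_mat p q r c (\<lambda>i k. Z * S i k))"
  proof (rule eq_block_matI[of _ p r q c])
    fix i a k b assume l: "i < p" "a < r" "k < q" "b < c"
    have d: "i * r + a < p * r" "k * c + b < q * c" using l by (simp_all add: block_index_less)
    note bm = carrier_matD[OF carrier_block_mat[of p q r c]]
    have "(U * F i k) $$ (a, b) - (F i k * V) $$ (a, b)
      = x * ((Y i k * W) $$ (a, b) + (Z * S i k) $$ (a, b))"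
      using arg_cong[OF eq[OF l(1,3)], of "\<lambda>M. M $$ (a, b)"] l
        carrier_matD[OF F[OF l(1,3)]] carrier_matD[OF Y[OF l(1,3)]] carrier_matD[OF S[OF l(1,3)]]
        carrier_matD[OF U] carrier_matD[OF V] carrier_matD[OF W] carrier_matD[OF Z]
      by (simp del: index_mult_mat(1))
    then show "(block_mat p q r c (\<lambda>i k. U * F i k) - block_mat p q r c (\<lambda>i k. F i k * V))
        $$ (i * r + a, k * c + b)
      = (x \<cdot>\<^sub>m (block_mat p q r c (\<lambda>i k. Y i k * W) + block_mat p q r c (\<lambda>i k. Z * S i k)))
        $$ (i * r + a, k * c + b)"
      using l d by (simp add: bm del: index_mult_mat(1))
  qed (auto intro: minus_carrier_mat)
  then show ?thesis
    by (simp only: kron_one_left_mult_block_mat[OF U F] kron_one_left_mult_block_mat[OF Z S]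
      block_mat_mult_kron_one_left[OF V F] block_mat_mult_kron_one_left[OF W Y])
qed

lemma half_sum_mult_left:
  assumes Y: "Y \<in> carrier_mat r' r" and X: "\<And>j. X j \<in> carrier_mat r c"
  shows "Y * half_sum r c X i = half_sum r' c (\<lambda>j. Y * X j) i"
proof (rule eq_matI)
  fix a b assume "a < dim_row (half_sum r' c (\<lambda>j. Y * X j) i)" "b < dim_col (half_sum r' c (\<lambda>j. Y * X j) i)"
  then have l: "a < r'" "b < c" by (simp_all add: half_sum_def)
  show "(Y * half_sum r c X i) $$ (a, b) = half_sum r' c (\<lambda>j. Y * X j) i $$ (a, b)"
    using l by (simp add: index_mult_mat_sum[OF Y carrier_half_sum] index_mult_mat_sum[OF Y X] 
      distrib_left sum.distrib sum_distrib_left sum.swap[of _ "{..<r}"] mult.left_commute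
      del: index_mult_mat(1))
qed (use Y in \<open>auto simp: half_sum_def\<close>)

lemma half_sum_mult_right:
  assumes Y: "Y \<in> carrier_mat c c'" and X: "\<And>j. X j \<in> carrier_mat r c"
  shows "half_sum r c X i * Y = half_sum r c' (\<lambda>j. X j * Y) i"
proof (rule eq_matI)
  fix a b assume "a < dim_row (half_sum r c' (\<lambda>j. X j * Y) i)" "b < dim_col (half_sum r c' (\<lambda>j. X j * Y) i)"
  then have l: "a < r" "b < c'" by (simp_all add: half_sum_def)
  show "(half_sum r c X i * Y) $$ (a, b) = half_sum r c' (\<lambda>j. X j * Y) i $$ (a, b)"
    using l by (simp add: index_mult_mat_sum[OF carrier_half_sum Y] index_mult_mat_sum[OF X Y] 
      distrib_right sum.distrib sum_distrib_left sum_distrib_right sum.swap[of _ "{..<c}"] mult.assoc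
      del: index_mult_mat(1))
qed (use Y in \<open>auto simp: half_sum_def\<close>)

text \<open>\<open>half_sum\<close> is linear in the family and commutes with multiplication by a fixed matrix, so a
displacement identity for all members of a family passes to its partial sums. This is how \<open>N\<close> and
\<open>K\<^sub>1\<^sub>1\<close>, which are sums in both directions, arise from \<open>M\<^sub>1\<^sub>1\<close>.\<close>

lemma half_sum_displacement:
  assumes U: "U \<in> carrier_mat r r" and V: "V \<in> carrier_mat c c"
    and W: "W \<in> carrier_mat d c" and Z: "Z \<in> carrier_mat r e"
    and F: "\<And>j. F j \<in> carrier_mat r c" and Y: "\<And>j. Y j \<in> carrier_mat r d"
    and S: "\<And>j. S j \<in> carrier_mat e c"
    and eq: "\<And>j. U * F j - F j * V = x \<cdot>\<^sub>m (Y j * W + Z * S j)"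
  shows "U * half_sum r c F i - half_sum r c F i * V
    = x \<cdot>\<^sub>m (half_sum r d Y i * W + Z * half_sum e c S i)"
proof -
  have "half_sum r c (\<lambda>j. U * F j) i - half_sum r c (\<lambda>j. F j * V) i
    = x \<cdot>\<^sub>m (half_sum r c (\<lambda>j. Y j * W) i + half_sum r c (\<lambda>j. Z * S j) i)" (is "?l = ?r")
  proof (rule eq_matI)
    fix a b assume "a < dim_row ?r" "b < dim_col ?r"
    then have l: "a < r" "b < c" by (simp_all add: half_sum_def)
    have "(U * F j) $$ (a, b) = (F j * V) $$ (a, b)
      + x * ((Y j * W) $$ (a, b) + (Z * S j) $$ (a, b))" for j
      using arg_cong[OF eq[of j], of "\<lambda>M. M $$ (a, b)"] l
        carrier_matD[OF F[of j]] carrier_matD[OF Y[of j]] carrier_matD[OF S[of j]]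
        carrier_matD[OF U] carrier_matD[OF V] carrier_matD[OF W] carrier_matD[OF Z]
      by (simp add: diff_eq_eq add.commute del: index_mult_mat(1))
    then show "?l $$ (a, b) = ?r $$ (a, b)"
      using l carrier_matD[OF carrier_half_sum[of r c]]
      by (simp add: sum.distrib sum_distrib_left distrib_left del: index_mult_mat(1))
  qed (auto simp: half_sum_def)
  then show ?thesis
    by (simp only: half_sum_mult_left[OF U F] half_sum_mult_left[OF Z S]
      half_sum_mult_right[OF V F] half_sum_mult_right[OF W Y])
qed

section \<open>Matrices split into columns\<close>

lemma carrier_append_cols [simp, intro]:
  "A \<in> carrier_mat n p \<Longrightarrow> B \<in> carrier_mat n q \<Longrightarrow> A @\<^sub>c B \<in> carrier_mat n (p + q)"
  by (auto simp: append_cols_def)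

lemma dim_append_cols [simp]:
  "dim_row (A @\<^sub>c B) = dim_row A" "dim_col (A @\<^sub>c B) = dim_col A + dim_col B"
  by (auto simp: append_cols_def)

lemma index_append_cols [simp]:
  "i < dim_row A \<Longrightarrow> j < dim_col A + dim_col B \<Longrightarrow>
    (A @\<^sub>c B) $$ (i, j) = (if j < dim_col A then A $$ (i, j) else B $$ (i, j - dim_col A))"
  by (auto simp: append_cols_def)

lemma append_cols_mult_four_block:
  assumes "A \<in> carrier_mat n p" "B \<in> carrier_mat n q"
    "C \<in> carrier_mat p a" "D \<in> carrier_mat p b" "E \<in> carrier_mat q a" "F \<in> carrier_mat q b"
  shows "(A @\<^sub>c B) * four_block_mat C D E F = (A * C + B * E) @\<^sub>c (A * D + B * F)"
  using assms unfolding append_cols_def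
  by (subst mult_four_block_mat[of A n p B q _ 0 _ C a D b]) auto

lemma mult_append_cols:
  assumes "X \<in> carrier_mat k n" "A \<in> carrier_mat n p" "B \<in> carrier_mat n q"
  shows "X * (A @\<^sub>c B) = (X * A) @\<^sub>c (X * B)"
  by (rule eq_matI) (use assms in \<open>auto simp: index_mult_mat_sum[OF assms(1) carrier_append_cols[OF assms(2,3)]]
    index_mult_mat_sum[OF assms(1,2)] index_mult_mat_sum[OF assms(1,3)] simp del: index_mult_mat(1)\<close>)

lemma append_cols_mult_append_rows:
  assumes "A \<in> carrier_mat n p" "B \<in> carrier_mat n q" "C \<in> carrier_mat p a" "D \<in> carrier_mat q a"
  shows "(A @\<^sub>c B) * (C @\<^sub>r D) = A * C + B * D"
proof -
  have "(A @\<^sub>c B) * (C @\<^sub>r D) = (A * C + B * D) @\<^sub>c (A * 0\<^sub>m p 0 + B * 0\<^sub>m q 0)"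
    using assms unfolding append_rows_def
    by (subst append_cols_mult_four_block[of A n p B q]) auto
  also have "\<dots> = A * C + B * D"
    using assms by (intro eq_matI) (auto simp del: index_mult_mat(1))
  finally show ?thesis .
qed

lemma append_cols_minus:
  assumes "A \<in> carrier_mat n p" "B \<in> carrier_mat n q" "C \<in> carrier_mat n p" "D \<in> carrier_mat n q"
  shows "(A @\<^sub>c B) - (C @\<^sub>c D) = (A - C) @\<^sub>c (B - D)"
  using assms by (intro eq_matI) auto

lemma append_cols_add:
  assumes "A \<in> carrier_mat n p" "B \<in> carrier_mat n q" "C \<in> carrier_mat n p" "D \<in> carrier_mat n q"
  shows "(A @\<^sub>c B) + (C @\<^sub>c D) = (A + C) @\<^sub>c (B + D)"
  using assms by (intro eq_matI) auto

lemma append_cols_smult: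
  "dim_row A = dim_row B \<Longrightarrow> x \<cdot>\<^sub>m (A @\<^sub>c B) = (x \<cdot>\<^sub>m A) @\<^sub>c (x \<cdot>\<^sub>m B)"
  by (intro eq_matI) auto

lemma append_cols_assoc:
  assumes "A \<in> carrier_mat n p" "B \<in> carrier_mat n q" "C \<in> carrier_mat n r"
  shows "(A @\<^sub>c B) @\<^sub>c C = A @\<^sub>c B @\<^sub>c C"
  using assms by (intro eq_matI) auto

text \<open>Assembles the two commutators for the halves \<open>P\<close>, \<open>Q\<close> of some \<open>\<Pi>\<close> into one. The columns \<open>U\<close> are
multiplied by the zero row of the block matrix on the right.\<close>

lemma append_cols_commutator:
  assumes A: "A \<in> carrier_mat n n" and S: "S \<in> carrier_mat k k"
    and P: "P \<in> carrier_mat n k" and Q: "Q \<in> carrier_mat n k"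
    and U: "U \<in> carrier_mat n b" and W: "W \<in> carrier_mat n b"
    and K: "K \<in> carrier_mat b k" and J: "J \<in> carrier_mat b k"
    and N: "N \<in> carrier_mat n d" and L: "L \<in> carrier_mat d k"
    and eqP: "A * P - P * S = x \<cdot>\<^sub>m (N * L + W * K)"
    and eqQ: "A * Q - Q * S = x \<cdot>\<^sub>m (W * J)"
  shows "A * (P @\<^sub>c Q) - (P @\<^sub>c Q) * four_block_mat S (0\<^sub>m k k) (0\<^sub>m k k) S
    = x \<cdot>\<^sub>m ((U @\<^sub>c W) * four_block_mat (0\<^sub>m b k) (0\<^sub>m b k) K J + N * (L @\<^sub>c 0\<^sub>m d k))"
proof -
  have "(P @\<^sub>c Q) * four_block_mat S (0\<^sub>m k k) (0\<^sub>m k k) S = (P * S) @\<^sub>c (Q * S)"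
    using P Q S by (subst append_cols_mult_four_block[OF P Q S]) auto
  then have "A * (P @\<^sub>c Q) - (P @\<^sub>c Q) * four_block_mat S (0\<^sub>m k k) (0\<^sub>m k k) S
    = (A * P - P * S) @\<^sub>c (A * Q - Q * S)"
    using A P Q S by (simp add: mult_append_cols[OF A P Q] append_cols_minus[of _ n k _ k])
  also have "\<dots> = (x \<cdot>\<^sub>m (N * L + W * K)) @\<^sub>c (x \<cdot>\<^sub>m (W * J))"
    by (simp only: eqP eqQ)
  also have "\<dots> = x \<cdot>\<^sub>m (((W * K) @\<^sub>c (W * J)) + ((N * L) @\<^sub>c 0\<^sub>m n k))"
    using N L W K J
    by (subst append_cols_add[of _ n k _ k]) (auto simp: append_cols_smult comm_add_mat[of _ n k])
  also have "(W * K) @\<^sub>c (W * J) = (U @\<^sub>c W) * four_block_mat (0\<^sub>m b k) (0\<^sub>m b k) K J"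
    using U W K J by (subst append_cols_mult_four_block[OF U W]) auto
  also have "(N * L) @\<^sub>c 0\<^sub>m n k = N * (L @\<^sub>c 0\<^sub>m d k)"
    using N L by (subst mult_append_cols[OF N L]) auto
  finally show ?thesis .
qed

section \<open>The algebraic mechanism\<close>

text \<open>The ring laws with side conditions on \<open>dim_row\<close> and \<open>dim_col\<close>. A carrier condition for a product
mentions an inner dimension that does not occur in the term, so rewriting with such conditions
gets stuck; conditions on dimensions are decided by simplification, which makes expansion of
products of rectangular matrices automatic.\<close>

lemma mat_ring_dim:
  fixes A B C :: "complex mat"
  shows mat_assoc_dim: "dim_col A = dim_row B \<Longrightarrow> dim_col B = dim_row C \<Longrightarrow> (A * B) * C = A * (B * C)"
    and mat_distr_add_dim: "dim_row B = dim_row C \<Longrightarrow> dim_col B = dim_col C \<Longrightarrow> dim_col A = dim_row B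
      \<Longrightarrow> A * (B + C) = A * B + A * C"
    and mat_distl_add_dim: "dim_row A = dim_row B \<Longrightarrow> dim_col A = dim_col B \<Longrightarrow> dim_col A = dim_row C
      \<Longrightarrow> (A + B) * C = A * C + B * C"
    and mat_distr_minus_dim: "dim_row B = dim_row C \<Longrightarrow> dim_col B = dim_col C \<Longrightarrow> dim_col A = dim_row B
      \<Longrightarrow> A * (B - C) = A * B - A * C"
    and mat_distl_minus_dim: "dim_row A = dim_row B \<Longrightarrow> dim_col A = dim_col B \<Longrightarrow> dim_col A = dim_row C
      \<Longrightarrow> (A - B) * C = A * C - B * C"
    and mat_smult_left_dim: "dim_col A = dim_row B \<Longrightarrow> (x \<cdot>\<^sub>m A) * B = x \<cdot>\<^sub>m (A * B)"
    and mat_smult_right_dim: "dim_col A = dim_row B \<Longrightarrow> A * (x \<cdot>\<^sub>m B) = x \<cdot>\<^sub>m (A * B)"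
    and mat_one_left_dim: "dim_row A = n \<Longrightarrow> 1\<^sub>m n * A = A"
    and mat_one_right_dim: "dim_col A = n \<Longrightarrow> A * 1\<^sub>m n = A"
  by (auto intro!: assoc_mult_mat mult_add_distrib_mat add_mult_distrib_mat mult_minus_distrib_mat
    minus_mult_distrib_mat mult_smult_assoc_mat mult_smult_distrib)

lemma shift_commutator:
  fixes A B X :: "complex mat"
  assumes A: "A \<in> carrier_mat n n" and B: "B \<in> carrier_mat k k" and X: "X \<in> carrier_mat n k"
  shows "(A - x \<cdot>\<^sub>m 1\<^sub>m n) * X - X * (B - x \<cdot>\<^sub>m 1\<^sub>m k) = A * X - X * B"
  by (rule eq_matI) (use A B X in \<open>auto simp: mat_ring_dim simp del: index_mult_mat(1)\<close>)

text \<open>The cancellation that proves the formula. Here \<open>A\<close> and \<open>A'\<close> stand for \<open>A\<^sub>p - \<mu>\<^sub>p\<close> and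
\<open>A\<^sub>p\<^sup>* - \<mu>\<^sub>p\<close>, \<open>P2\<close> and \<open>P2h\<close> for \<open>\<Pi>\<^sub>p\<close> and its hatted partner, \<open>P1\<close> for the other \<open>\<Pi>\<close>, \<open>E\<close> for the
diagonal block of the matrix function, and \<open>F\<close> for what is subtracted in its off-diagonal block.
Conjugating \<open>disp\<close> by the inverse \<open>R\<close> turns it into \<open>RA - A'R = \<i>R P2 P2h R\<close>. The resulting term
\<open>w A' R P1\<close> is cancelled by \<open>y P2h R P1\<close>, and \<open>w R A P1 - w R P1 E\<close> is evaluated by \<open>dispP\<close>.\<close>

lemma resolvent_coupling:
  fixes T R A A' P1 P2 P2h E F N Z w y y1 :: "complex mat"
  assumes T: "T \<in> carrier_mat n n" and R: "R \<in> carrier_mat n n"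
    and RT: "R * T = 1\<^sub>m n" and TR: "T * R = 1\<^sub>m n"
    and A: "A \<in> carrier_mat n n" and A': "A' \<in> carrier_mat n n"
    and P1: "P1 \<in> carrier_mat n a" and P2: "P2 \<in> carrier_mat n b" and P2h: "P2h \<in> carrier_mat b n"
    and E: "E \<in> carrier_mat a a" and F: "F \<in> carrier_mat b a" and N: "N \<in> carrier_mat n d"
    and Z: "Z \<in> carrier_mat d a" and w: "w \<in> carrier_mat d n"
    and y: "y \<in> carrier_mat d b" and y1: "y1 \<in> carrier_mat d a"
    and disp: "A * T - T * A' = \<i> \<cdot>\<^sub>m (P2 * P2h)"
    and dispP: "A * P1 - P1 * E = \<i> \<cdot>\<^sub>m (P2 * F + N * Z)"
    and yP: "y * P2h = w * A'" and yF: "y * F = 0\<^sub>m d a" and y1E: "y1 * E = Z"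
  shows "(w * (R * P1) - \<i> \<cdot>\<^sub>m y1) * E + (w * (R * P2) - \<i> \<cdot>\<^sub>m y) * ((- \<i>) \<cdot>\<^sub>m (P2h * (R * P1) - F))
    = (- \<i>) \<cdot>\<^sub>m (1\<^sub>m d + w * (R * N)) * Z"
proof -
  note dims = carrier_matD[OF T] carrier_matD[OF R] carrier_matD[OF A] carrier_matD[OF A']
    carrier_matD[OF P1] carrier_matD[OF P2] carrier_matD[OF P2h] carrier_matD[OF E]
    carrier_matD[OF F] carrier_matD[OF N] carrier_matD[OF Z] carrier_matD[OF w]
    carrier_matD[OF y] carrier_matD[OF y1]
  \<comment> \<open>With products associated to the right, \<open>T\<close> and \<open>R\<close> cancel only in front of a further factor.\<close>
  have RTX: "R * (T * X) = X" if "dim_row X = n" for X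
    using that by (simp add: dims RT mat_ring_dim flip: mat_assoc_dim)
  have TRX: "T * (R * X) = X" if "dim_row X = n" for X
    using that by (simp add: dims TR mat_ring_dim flip: mat_assoc_dim)
  have yPX: "y * (P2h * X) = w * (A' * X)" if "dim_row X = n" for X
    using that by (simp add: dims yP mat_ring_dim flip: mat_assoc_dim)
  have h1: "w * (R * (A * P1)) - w * (A' * (R * P1)) = \<i> \<cdot>\<^sub>m (w * (R * (P2 * (P2h * (R * P1)))))"
    using arg_cong[OF disp, of "\<lambda>M. w * (R * (M * (R * P1)))"]
    by (simp add: mat_ring_dim dims RTX TRX)
  have h2: "w * (R * (A * P1)) - w * (R * (P1 * E)) = \<i> \<cdot>\<^sub>m (w * (R * (P2 * F)) + w * (R * (N * Z)))"
    using arg_cong[OF dispP, of "\<lambda>M. w * (R * M)"]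
    by (simp add: mat_ring_dim dims)
  show ?thesis
  proof (rule eq_matI)
    fix i j assume "i < dim_row ((- \<i>) \<cdot>\<^sub>m (1\<^sub>m d + w * (R * N)) * Z)"
      "j < dim_col ((- \<i>) \<cdot>\<^sub>m (1\<^sub>m d + w * (R * N)) * Z)"
    then have l: "i < d" "j < a" by (simp_all add: dims)
    have e1: "(w * (R * (A * P1))) $$ (i, j) - (w * (A' * (R * P1))) $$ (i, j)
      = \<i> * (w * (R * (P2 * (P2h * (R * P1))))) $$ (i, j)"
      using arg_cong[OF h1, of "\<lambda>M. M $$ (i, j)"] l by (simp add: dims del: index_mult_mat(1))
    have e2: "(w * (R * (A * P1))) $$ (i, j) - (w * (R * (P1 * E))) $$ (i, j)
      = \<i> * ((w * (R * (P2 * F))) $$ (i, j) + (w * (R * (N * Z))) $$ (i, j))"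
      using arg_cong[OF h2, of "\<lambda>M. M $$ (i, j)"] l by (simp add: dims del: index_mult_mat(1))
    have "((w * (R * P1) - \<i> \<cdot>\<^sub>m y1) * E + (w * (R * P2) - \<i> \<cdot>\<^sub>m y) * ((- \<i>) \<cdot>\<^sub>m (P2h * (R * P1) - F))) $$ (i, j)
      = (w * (R * (P1 * E))) $$ (i, j) - \<i> * Z $$ (i, j)
        - \<i> * ((w * (R * (P2 * (P2h * (R * P1))))) $$ (i, j) - (w * (R * (P2 * F))) $$ (i, j))
        - (w * (A' * (R * P1))) $$ (i, j)"
      using l by (simp add: mat_ring_dim dims y1E yPX yF algebra_simps del: index_mult_mat(1))
    also have "\<dots> = - \<i> * (Z $$ (i, j) + (w * (R * (N * Z))) $$ (i, j))"
      using e1 e2 by (simp add: algebra_simps)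
    also have "\<dots> = ((- \<i>) \<cdot>\<^sub>m (1\<^sub>m d + w * (R * N)) * Z) $$ (i, j)"
      using l by (simp add: mat_ring_dim dims del: index_mult_mat(1))
    finally show "((w * (R * P1) - \<i> \<cdot>\<^sub>m y1) * E + (w * (R * P2) - \<i> \<cdot>\<^sub>m y) * ((- \<i>) \<cdot>\<^sub>m (P2h * (R * P1) - F))) $$ (i, j)
      = ((- \<i>) \<cdot>\<^sub>m (1\<^sub>m d + w * (R * N)) * Z) $$ (i, j)" .
  qed (simp_all add: dims)
qed

section \<open>The matrices attached to a block TBT-matrix\<close>

lemma kron_mult_dim:
  "dim_col A = dim_row C \<Longrightarrow> dim_col B = dim_row D \<Longrightarrow>
    (A \<otimes>\<^sub>K B) * (C \<otimes>\<^sub>K D) = (A * C) \<otimes>\<^sub>K (B * D)"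
  by (rule kron_mult[OF carrier_matI[OF refl refl] carrier_matI[OF refl refl]]) auto

lemma ones_mult: "ones (p * q) = ones p \<otimes>\<^sub>K ones q"
proof (rule eq_block_matI[of _ p q 1 1])
  fix i a k b :: nat assume l: "i < p" "a < q" "k < 1" "b < 1"
  then show "ones (p * q) $$ (i * q + a, k * 1 + b) = (ones p \<otimes>\<^sub>K ones q) $$ (i * q + a, k * 1 + b)"
    by (subst index_kron[OF carrier_ones carrier_ones]) (auto simp: ones_def block_index_less)
qed (use carrier_kron[OF carrier_ones[of p] carrier_ones[of q]] in auto)

text \<open>Each level gets one Kronecker factor: for the outer level the inner two are merged, for the inner
level they are kept together on the right. Then the mixed product rule computes all products.\<close>

lemma A1_eq: "A1 m1 m2 m3 = calA m1 \<otimes>\<^sub>K 1\<^sub>m (m2 * m3)"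
  by (simp add: A1_def kron_assoc kron_one_one)

lemma A2_eq: "A2 m1 m2 m3 = 1\<^sub>m m1 \<otimes>\<^sub>K (calA m2 \<otimes>\<^sub>K 1\<^sub>m m3)"
  by (simp add: A2_def kron_assoc)

lemma calL_adjoint_eq: "mat_adjoint (calL n m3) = mat_adjoint (ones n) \<otimes>\<^sub>K 1\<^sub>m m3"
  by (simp add: calL_def mat_adjoint_kron)

lemma calL_mult_adjoint_eq:
  "mat_adjoint (calL (m1 * m2) m3) = mat_adjoint (ones m1) \<otimes>\<^sub>K (mat_adjoint (ones m2) \<otimes>\<^sub>K 1\<^sub>m m3)"
  by (simp add: calL_adjoint_eq ones_mult mat_adjoint_kron kron_assoc)

lemma M31_eq: "M31 m1 m2 m3 = ones m1 \<otimes>\<^sub>K 1\<^sub>m (m2 * m3)"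
  by (simp add: M31_def M21_def mat_adjoint_kron)

lemma M22_eq: "M22 m1 m2 m3 = 1\<^sub>m m1 \<otimes>\<^sub>K mat_adjoint (calL m2 m3)"
  by (simp add: M22_def calL_adjoint_eq kron_assoc)

lemma M32_eq: "M32 m1 m2 m3 = 1\<^sub>m m1 \<otimes>\<^sub>K calL m2 m3"
  by (simp add: M32_def M22_eq mat_adjoint_kron)

lemma carrier_calL [simp, intro]: "calL n m3 \<in> carrier_mat (n * m3) m3"
  using carrier_kron[OF carrier_ones[of n] one_carrier_mat[of m3]] by (simp add: calL_def)

lemma dim_calL [simp]: "dim_row (calL n m3) = n * m3" "dim_col (calL n m3) = m3"
  by (simp_all add: calL_def)

lemma carrier_block_families [simp, intro]:
  "TBT_block m2 m3 t r \<in> carrier_mat (m2 * m3) (m2 * m3)"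
  "M12_block m2 m3 t r \<in> carrier_mat (m2 * m3) m3"
  "M42_block m2 m3 t r \<in> carrier_mat m3 (m2 * m3)"
  by (auto simp: TBT_block_def M12_block_def M42_block_def)

lemma carrier_block_matrices [simp, intro]:
  "block_TBT m1 m2 m3 t \<in> carrier_mat (m1 * (m2 * m3)) (m1 * (m2 * m3))"
  "A1 m1 m2 m3 \<in> carrier_mat (m1 * (m2 * m3)) (m1 * (m2 * m3))"
  "A2 m1 m2 m3 \<in> carrier_mat (m1 * (m2 * m3)) (m1 * (m2 * m3))"
  "M11 m1 m2 m3 t \<in> carrier_mat (m1 * (m2 * m3)) (m2 * m3)"
  "M21 m1 m2 m3 \<in> carrier_mat (m2 * m3) (m1 * (m2 * m3))"
  "M31 m1 m2 m3 \<in> carrier_mat (m1 * (m2 * m3)) (m2 * m3)"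
  "M41 m1 m2 m3 t \<in> carrier_mat (m2 * m3) (m1 * (m2 * m3))"
  "M12 m1 m2 m3 t \<in> carrier_mat (m1 * (m2 * m3)) (m1 * m3)"
  "M22 m1 m2 m3 \<in> carrier_mat (m1 * m3) (m1 * (m2 * m3))"
  "M32 m1 m2 m3 \<in> carrier_mat (m1 * (m2 * m3)) (m1 * m3)"
  "M42 m1 m2 m3 t \<in> carrier_mat (m1 * m3) (m1 * (m2 * m3))"
  "K11 m1 m2 m3 t \<in> carrier_mat (m1 * m3) (m2 * m3)"
  "K12 m1 m2 m3 t \<in> carrier_mat (m2 * m3) (m1 * m3)"
  "Nmat m1 m2 m3 t \<in> carrier_mat (m1 * (m2 * m3)) m3"
proof -
  show "M21 m1 m2 m3 \<in> carrier_mat (m2 * m3) (m1 * (m2 * m3))"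
    by (rule carrier_matI) (simp_all add: M21_def)
qed (auto simp: block_TBT_def A1_eq A2_eq M11_def M31_eq M41_def M12_def M22_eq M32_eq
    M42_def K11_def K12_def Nmat_def intro!: carrier_matI)

lemmas dim_block_matrices [simp] = carrier_block_matrices[THEN carrier_matD(1)]
  carrier_block_matrices[THEN carrier_matD(2)]

text \<open>In direction 1 the displacement identity is applied to the outer level, whose blocks are again
matrices with blocks. In direction 2 it is applied inside each block and then lifted.\<close>

lemma displacement_T_1:
  "A1 m1 m2 m3 * block_TBT m1 m2 m3 t - block_TBT m1 m2 m3 t * mat_adjoint (A1 m1 m2 m3)
    = \<i> \<cdot>\<^sub>m (M11 m1 m2 m3 t * M21 m1 m2 m3 + M31 m1 m2 m3 * M41 m1 m2 m3 t)"
  using toeplitz_displacement[of m1 "m2 * m3" "m2 * m3" "TBT_block m2 m3 t"]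
  by (simp add: A1_eq mat_adjoint_kron block_TBT_def M11_def M21_def M31_eq M41_def)

lemma displacement_M12:
  "A1 m1 m2 m3 * M12 m1 m2 m3 t - M12 m1 m2 m3 t * (mat_adjoint (calA m1) \<otimes>\<^sub>K 1\<^sub>m m3)
    = \<i> \<cdot>\<^sub>m (Nmat m1 m2 m3 t * mat_adjoint (calL m1 m3) + M31 m1 m2 m3 * K12 m1 m2 m3 t)"
  using toeplitz_displacement[of m1 "m2 * m3" m3 "M12_block m2 m3 t"]
  by (simp add: A1_eq M12_def Nmat_def calL_adjoint_eq M31_eq K12_def)

lemma displacement_TBT_block:
  "(calA m2 \<otimes>\<^sub>K 1\<^sub>m m3) * TBT_block m2 m3 t r
     - TBT_block m2 m3 t r * (mat_adjoint (calA m2) \<otimes>\<^sub>K 1\<^sub>m m3)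
    = \<i> \<cdot>\<^sub>m (M12_block m2 m3 t r * mat_adjoint (calL m2 m3) + calL m2 m3 * M42_block m2 m3 t r)"
  using toeplitz_displacement[of m2 m3 m3 "t r"]
  by (simp add: TBT_block_def M12_block_def M42_block_def calL_adjoint_eq calL_def mat_adjoint_kron)

lemma displacement_T_2:
  "A2 m1 m2 m3 * block_TBT m1 m2 m3 t - block_TBT m1 m2 m3 t * mat_adjoint (A2 m1 m2 m3)
    = \<i> \<cdot>\<^sub>m (M12 m1 m2 m3 t * M22 m1 m2 m3 + M32 m1 m2 m3 * M42 m1 m2 m3 t)"
  unfolding A2_eq mat_adjoint_kron mat_adjoint_one block_TBT_def block_toeplitz_def M12_def M22_eq M32_eq M42_def
  by (rule block_mat_displacement[OF _ _ _ _ _ _ _ displacement_TBT_block])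
    auto

lemma displacement_M11:
  "A2 m1 m2 m3 * M11 m1 m2 m3 t - M11 m1 m2 m3 t * (mat_adjoint (calA m2) \<otimes>\<^sub>K 1\<^sub>m m3)
    = \<i> \<cdot>\<^sub>m (Nmat m1 m2 m3 t * mat_adjoint (calL m2 m3) + M32 m1 m2 m3 * K11 m1 m2 m3 t)"
proof -
  have "A2 m1 m2 m3 * M11 m1 m2 m3 t
      - M11 m1 m2 m3 t * (1\<^sub>m 1 \<otimes>\<^sub>K (mat_adjoint (calA m2) \<otimes>\<^sub>K 1\<^sub>m m3))
    = \<i> \<cdot>\<^sub>m (Nmat m1 m2 m3 t * (1\<^sub>m 1 \<otimes>\<^sub>K mat_adjoint (calL m2 m3)) + M32 m1 m2 m3 * K11 m1 m2 m3 t)"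
    unfolding A2_eq M11_def block_col_def Nmat_def M32_eq K11_def
    by (rule block_mat_displacement[OF _ _ _ _ _ _ _
        half_sum_displacement[OF _ _ _ _ _ _ _ displacement_TBT_block]])
      auto
  then show ?thesis by (simp only: kron_one_left)
qed

text \<open>The matrices of ones in \<open>\<Pi>\<^sub>1\<close> and \<open>\<Pi>\<^sub>2\<close> only see
\<open>\<A> - \<A>\<^sup>* = \<i> 1 1\<^sup>*\<close> on the Kronecker factor of the other direction. A factor without outer level is
read as \<open>1\<^sub>m 1 \<otimes>\<^sub>K _\<close> to make the mixed product rule applicable.\<close>

lemma displacement_M31:
  "A2 m1 m2 m3 * M31 m1 m2 m3 - M31 m1 m2 m3 * (mat_adjoint (calA m2) \<otimes>\<^sub>K 1\<^sub>m m3)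
    = \<i> \<cdot>\<^sub>m (M32 m1 m2 m3 * (calL m1 m3 * mat_adjoint (calL m2 m3)))"
proof -
  have o: "ones m1 \<in> carrier_mat m1 1" and a: "calA m2 \<in> carrier_mat m2 m2"
    "mat_adjoint (calA m2) \<in> carrier_mat m2 m2"
    and oo: "ones m2 * mat_adjoint (ones m2) \<in> carrier_mat m2 m2"
    by auto
  have "M31 m1 m2 m3 * (mat_adjoint (calA m2) \<otimes>\<^sub>K 1\<^sub>m m3)
    = (ones m1 \<otimes>\<^sub>K 1\<^sub>m (m2 * m3)) * (1\<^sub>m 1 \<otimes>\<^sub>K (mat_adjoint (calA m2) \<otimes>\<^sub>K 1\<^sub>m m3))"
    by (simp only: M31_eq kron_one_left)
  also have "\<dots> = ones m1 \<otimes>\<^sub>K (mat_adjoint (calA m2) \<otimes>\<^sub>K 1\<^sub>m m3)"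
    by (simp add: kron_mult_dim mat_ring_dim)
  finally have 1: "M31 m1 m2 m3 * (mat_adjoint (calA m2) \<otimes>\<^sub>K 1\<^sub>m m3)
    = ones m1 \<otimes>\<^sub>K (mat_adjoint (calA m2) \<otimes>\<^sub>K 1\<^sub>m m3)" .
  have 2: "A2 m1 m2 m3 * M31 m1 m2 m3 = ones m1 \<otimes>\<^sub>K (calA m2 \<otimes>\<^sub>K 1\<^sub>m m3)"
    by (simp add: A2_eq M31_eq kron_mult_dim mat_ring_dim)
  have "M32 m1 m2 m3 * (calL m1 m3 * mat_adjoint (calL m2 m3))
    = (1\<^sub>m m1 \<otimes>\<^sub>K calL m2 m3) * (ones m1 \<otimes>\<^sub>K 1\<^sub>m m3) * (1\<^sub>m 1 \<otimes>\<^sub>K mat_adjoint (calL m2 m3))"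
    unfolding kron_one_left M32_eq calL_def[of m1] by (simp add: mat_assoc_dim)
  also have "\<dots> = ones m1 \<otimes>\<^sub>K ((ones m2 * mat_adjoint (ones m2)) \<otimes>\<^sub>K 1\<^sub>m m3)"
    by (simp add: kron_mult_dim mat_ring_dim calL_def mat_adjoint_kron)
  finally have 3: "M32 m1 m2 m3 * (calL m1 m3 * mat_adjoint (calL m2 m3))
    = ones m1 \<otimes>\<^sub>K ((ones m2 * mat_adjoint (ones m2)) \<otimes>\<^sub>K 1\<^sub>m m3)" .
  show ?thesis
    unfolding 1 2 3 kron_minus_right[OF o carrier_kron[OF a(1) one_carrier_mat] carrier_kron[OF a(2) one_carrier_mat], symmetric]
      kron_minus_left[OF a one_carrier_mat, symmetric] calA_minus_adjoint
      kron_smult_left[OF oo one_carrier_mat] kron_smult_right[OF o carrier_kron[OF oo one_carrier_mat]] ..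
qed

lemma displacement_M32:
  "A1 m1 m2 m3 * M32 m1 m2 m3 - M32 m1 m2 m3 * (mat_adjoint (calA m1) \<otimes>\<^sub>K 1\<^sub>m m3)
    = \<i> \<cdot>\<^sub>m (M31 m1 m2 m3 * (calL m2 m3 * mat_adjoint (calL m1 m3)))"
proof -
  have a: "calA m1 \<in> carrier_mat m1 m1" "mat_adjoint (calA m1) \<in> carrier_mat m1 m1"
    and oo: "ones m1 * mat_adjoint (ones m1) \<in> carrier_mat m1 m1"
    by auto
  have 1: "M32 m1 m2 m3 * (mat_adjoint (calA m1) \<otimes>\<^sub>K 1\<^sub>m m3) = mat_adjoint (calA m1) \<otimes>\<^sub>K calL m2 m3"
    by (simp add: M32_eq kron_mult_dim mat_ring_dim)
  have 2: "A1 m1 m2 m3 * M32 m1 m2 m3 = calA m1 \<otimes>\<^sub>K calL m2 m3"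
    by (simp add: A1_eq M32_eq kron_mult_dim mat_ring_dim)
  have "M31 m1 m2 m3 * (calL m2 m3 * mat_adjoint (calL m1 m3))
    = (ones m1 \<otimes>\<^sub>K 1\<^sub>m (m2 * m3)) * (1\<^sub>m 1 \<otimes>\<^sub>K calL m2 m3) * (mat_adjoint (ones m1) \<otimes>\<^sub>K 1\<^sub>m m3)"
    unfolding kron_one_left M31_eq calL_adjoint_eq by (simp add: mat_assoc_dim)
  also have "\<dots> = (ones m1 * mat_adjoint (ones m1)) \<otimes>\<^sub>K calL m2 m3"
    by (simp add: kron_mult_dim mat_ring_dim)
  finally have 3: "M31 m1 m2 m3 * (calL m2 m3 * mat_adjoint (calL m1 m3))
    = (ones m1 * mat_adjoint (ones m1)) \<otimes>\<^sub>K calL m2 m3" .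
  show ?thesis
    unfolding 1 2 3 kron_minus_left[OF a carrier_calL, symmetric] calA_minus_adjoint
      kron_smult_left[OF oo carrier_calL] ..
qed

section \<open>Resolvents\<close>

lemma carrier_adj_shift [simp, intro]: "X \<in> carrier_mat n n \<Longrightarrow> adj_shift X \<mu> \<in> carrier_mat n n"
  unfolding adj_shift_def by auto

lemma adj_shift_kron_one:
  assumes B: "B \<in> carrier_mat n n"
  shows "adj_shift (B \<otimes>\<^sub>K 1\<^sub>m r) \<mu> = adj_shift B \<mu> \<otimes>\<^sub>K 1\<^sub>m r"
  using B by (simp add: adj_shift_def mat_adjoint_kron kron_minus_left[of _ n n _ _ r r]
    kron_smult_left[of _ n n _ r r] kron_one_one)

lemma adj_shift_one_kron:
  assumes B: "B \<in> carrier_mat n n"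
  shows "adj_shift (1\<^sub>m r \<otimes>\<^sub>K B) \<mu> = 1\<^sub>m r \<otimes>\<^sub>K adj_shift B \<mu>"
  using B by (simp add: adj_shift_def mat_adjoint_kron kron_minus_right[of _ r r _ n n]
    kron_smult_right[of _ r r _ n n] kron_one_one)

text \<open>The matrix \<open>S\<close> is upper triangular with constant diagonal \<open>-\<i>/2 - \<mu>\<close>; this is where the excluded
value of \<open>\<mu>\<close> enters.\<close>

lemma minv_adj_shift_calA:
  fixes n :: nat and \<mu> :: complex
  assumes "\<mu> \<noteq> - \<i> / 2"
  defines "S \<equiv> adj_shift (calA n) \<mu>"
  shows "minv S \<in> carrier_mat n n" "S * minv S = 1\<^sub>m n" "minv S * S = 1\<^sub>m n"
proof -
  have S: "S \<in> carrier_mat n n" by (auto simp: S_def)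
  have "upper_triangular S"
    unfolding upper_triangular_def using S
    by (auto simp: S_def adj_shift_def calA_def)
  then have "det S = prod_list (diag_mat S)" using det_upper_triangular S by blast
  also have "diag_mat S = map (\<lambda>_. - \<i> / 2 - \<mu>) [0..<n]"
    unfolding diag_mat_def using S by (auto simp: S_def adj_shift_def calA_def)
  also have "prod_list \<dots> \<noteq> 0" using assms by auto
  finally have "det S \<noteq> 0" .
  from minv_det_nonzero[OF S this]
  show "minv S \<in> carrier_mat n n" "S * minv S = 1\<^sub>m n" "minv S * S = 1\<^sub>m n" by auto
qed

lemma minv_adj_shift_A1:
  assumes "\<mu> \<noteq> - \<i> / 2"
  shows "minv (adj_shift (A1 m1 m2 m3) \<mu>) = minv (adj_shift (calA m1) \<mu>) \<otimes>\<^sub>K 1\<^sub>m (m2 * m3)"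
proof -
  note S = carrier_adj_shift[OF carrier_calA[of m1], of \<mu>] and i = minv_adj_shift_calA[OF assms, of m1]
  show ?thesis unfolding A1_eq adj_shift_kron_one[OF carrier_calA]
    by (rule minv_unique[OF carrier_kron[OF S one_carrier_mat] carrier_kron[OF i(1) one_carrier_mat]])
      (simp add: kron_mult[OF S one_carrier_mat i(1) one_carrier_mat] i(2) kron_one_one)
qed

lemma minv_adj_shift_A2:
  assumes "\<mu> \<noteq> - \<i> / 2"
  shows "minv (adj_shift (A2 m1 m2 m3) \<mu>) = 1\<^sub>m m1 \<otimes>\<^sub>K (minv (adj_shift (calA m2) \<mu>) \<otimes>\<^sub>K 1\<^sub>m m3)"
proof -
  note S = carrier_adj_shift[OF carrier_calA[of m2], of \<mu>] and i = minv_adj_shift_calA[OF assms, of m2]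
  note S' = carrier_kron[OF S one_carrier_mat[of m3]] and i' = carrier_kron[OF i(1) one_carrier_mat[of m3]]
  show ?thesis unfolding A2_eq adj_shift_kron_one[OF carrier_calA]
      adj_shift_one_kron[OF carrier_kron[OF carrier_calA one_carrier_mat]]
    by (rule minv_unique[OF carrier_kron[OF one_carrier_mat S'] carrier_kron[OF one_carrier_mat i']])
      (simp add: kron_mult[OF one_carrier_mat S' one_carrier_mat i']
        kron_mult[OF S one_carrier_mat i(1) one_carrier_mat] i(2) kron_one_one)
qed

text \<open>The matrix \<open>w\<close> is the Kronecker product of a row \<open>c1\<close> for direction 1, a row \<open>c2\<close> for direction 2
and the identity.
Multiplying \<open>w\<close> by one of the shifted matrices removes one resolvent, which leaves a row of ones
in that direction; this is what makes the correction terms of \<open>u\<^sub>1\<close> and \<open>u\<^sub>2\<close> match.\<close>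

lemma calL_resolvent_prod:
  fixes m1 m2 m3 :: nat and \<mu>1 \<mu>2 :: complex
  assumes "\<mu>1 \<noteq> - \<i> / 2" "\<mu>2 \<noteq> - \<i> / 2"
  defines "w \<equiv> mat_adjoint (calL (m1 * m2) m3) * resolvent_prod m1 m2 m3 \<mu>1 \<mu>2"
    and "c1 \<equiv> mat_adjoint (ones m1) * minv (adj_shift (calA m1) \<mu>1)"
    and "c2 \<equiv> mat_adjoint (ones m2) * minv (adj_shift (calA m2) \<mu>2)"
  shows "w \<in> carrier_mat m3 (m1 * (m2 * m3))"
    and "(c1 \<otimes>\<^sub>K 1\<^sub>m m3) * M22 m1 m2 m3 = w * adj_shift (A2 m1 m2 m3) \<mu>2"
    and "(c2 \<otimes>\<^sub>K 1\<^sub>m m3) * M21 m1 m2 m3 = w * adj_shift (A1 m1 m2 m3) \<mu>1"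
proof -
  let ?S1 = "adj_shift (calA m1) \<mu>1" and ?S2 = "adj_shift (calA m2) \<mu>2"
  note i1 = minv_adj_shift_calA[OF assms(1), of m1] and i2 = minv_adj_shift_calA[OF assms(2), of m2]
  note dims = carrier_matD[OF i1(1)] carrier_matD[OF i2(1)]
    carrier_matD[OF carrier_adj_shift[OF carrier_calA[of m1], of \<mu>1]]
    carrier_matD[OF carrier_adj_shift[OF carrier_calA[of m2], of \<mu>2]]
  have w: "w = c1 \<otimes>\<^sub>K (c2 \<otimes>\<^sub>K 1\<^sub>m m3)"
    by (simp add: w_def c1_def c2_def resolvent_prod_def minv_adj_shift_A1[OF assms(1)]
      minv_adj_shift_A2[OF assms(2)] calL_mult_adjoint_eq kron_mult_dim mat_ring_dim dims)
  show "w \<in> carrier_mat m3 (m1 * (m2 * m3))"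
    unfolding w by (rule carrier_matI) (simp_all add: c1_def c2_def dims)
  have "c1 * ?S1 = mat_adjoint (ones m1)" "c2 * ?S2 = mat_adjoint (ones m2)"
    by (simp_all add: c1_def c2_def mat_ring_dim dims i1 i2)
  note cS = this
  have c: "dim_row c1 = 1" "dim_col c1 = m1" "dim_row c2 = 1" "dim_col c2 = m2"
    by (simp_all add: c1_def c2_def dims)
  have "w * adj_shift (A2 m1 m2 m3) \<mu>2 = c1 \<otimes>\<^sub>K (mat_adjoint (ones m2) \<otimes>\<^sub>K 1\<^sub>m m3)"
    unfolding A2_eq adj_shift_one_kron[OF carrier_kron[OF carrier_calA one_carrier_mat]]
      adj_shift_kron_one[OF carrier_calA] w
    by (simp add: kron_mult_dim c dims cS mat_ring_dim)
  then show "(c1 \<otimes>\<^sub>K 1\<^sub>m m3) * M22 m1 m2 m3 = w * adj_shift (A2 m1 m2 m3) \<mu>2"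
    by (simp add: M22_eq kron_mult_dim c mat_ring_dim calL_adjoint_eq)
  have "(c2 \<otimes>\<^sub>K 1\<^sub>m m3) * M21 m1 m2 m3 
    = (1\<^sub>m 1 \<otimes>\<^sub>K (c2 \<otimes>\<^sub>K 1\<^sub>m m3)) * (mat_adjoint (ones m1) \<otimes>\<^sub>K 1\<^sub>m (m2 * m3))"
    by (simp only: M21_def kron_one_left)
  also have "\<dots> = mat_adjoint (ones m1) \<otimes>\<^sub>K (c2 \<otimes>\<^sub>K 1\<^sub>m m3)"
    by (simp add: kron_mult_dim c mat_ring_dim)
  also have "\<dots> = w * adj_shift (A1 m1 m2 m3) \<mu>1"
    unfolding A1_eq adj_shift_kron_one[OF carrier_calA] w
    by (simp add: kron_mult_dim c dims cS mat_ring_dim)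
  finally show "(c2 \<otimes>\<^sub>K 1\<^sub>m m3) * M21 m1 m2 m3 = w * adj_shift (A1 m1 m2 m3) \<mu>1" .
qed

section \<open>The column identities and the formula\<close>

text \<open>The matrix \<open>y\<close> is the correction term without its factor \<open>\<i>\<close>. It consists of \<open>c\<close> followed by
zeros, so it selects the upper half of whatever it multiplies. Hence it annihilates the matrices
subtracted in \<open>E\<^sub>1\<^sub>2\<close> and \<open>E\<^sub>2\<^sub>1\<close>, whose upper halves vanish, and against the diagonal block of \<open>E\<close> its
resolvent cancels.\<close>

lemma u_corr_factor:
  fixes n m3 :: nat and \<mu> :: complex
  assumes \<mu>: "\<mu> \<noteq> - \<i> / 2"
  defines "c \<equiv> (mat_adjoint (ones n) * minv (adj_shift (calA n) \<mu>)) \<otimes>\<^sub>K 1\<^sub>m m3"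
  defines "y \<equiv> c * (1\<^sub>m (n * m3) @\<^sub>c 0\<^sub>m (n * m3) (n * m3))"
  shows "y \<in> carrier_mat m3 (n * m3 + n * m3)"
    and "y * E_diag n m3 \<mu> = mat_adjoint (calL n m3) @\<^sub>c 0\<^sub>m m3 (n * m3)"
    and "B \<in> carrier_mat (n * m3) k \<Longrightarrow> C \<in> carrier_mat (n * m3) k \<Longrightarrow> y * (B @\<^sub>r C) = c * B"
    and "K \<in> carrier_mat (n * m3) k \<Longrightarrow> J \<in> carrier_mat (n * m3) k \<Longrightarrow>
      y * four_block_mat (0\<^sub>m (n * m3) k) (0\<^sub>m (n * m3) k) K J = 0\<^sub>m m3 (k + k)"
proof -
  let ?S = "adj_shift (calA n) \<mu>"
  note i = minv_adj_shift_calA[OF \<mu>, of n]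
  have S: "?S \<in> carrier_mat n n" by auto
  have o: "mat_adjoint (ones n) \<in> carrier_mat 1 n" by auto
  have c: "c \<in> carrier_mat m3 (n * m3)"
    using carrier_kron[OF mult_carrier_mat[OF o i(1)] one_carrier_mat[of m3]] by (simp add: c_def)
  have y: "y = c @\<^sub>c 0\<^sub>m m3 (n * m3)"
    using c unfolding y_def by (subst mult_append_cols[OF c]) auto
  have z: "0\<^sub>m m3 (n * m3) \<in> carrier_mat m3 (n * m3)" by auto
  show "y \<in> carrier_mat m3 (n * m3 + n * m3)" using c by (auto simp: y)
  have S1: "?S \<otimes>\<^sub>K 1\<^sub>m m3 \<in> carrier_mat (n * m3) (n * m3)" using S by auto
  have "c * (?S \<otimes>\<^sub>K 1\<^sub>m m3) = mat_adjoint (calL n m3)"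
    unfolding c_def calL_adjoint_eq
    using i o S by (simp add: kron_mult_dim mat_ring_dim carrier_matD[OF i(1)] carrier_matD[OF S])
  then show "y * E_diag n m3 \<mu> = mat_adjoint (calL n m3) @\<^sub>c 0\<^sub>m m3 (n * m3)"
    using c S1 unfolding y E_diag_def by (subst append_cols_mult_four_block[OF c z S1]) (auto simp: left_mult_zero_mat[OF S1])
  show "y * (B @\<^sub>r C) = c * B" if "B \<in> carrier_mat (n * m3) k" "C \<in> carrier_mat (n * m3) k"
    using that c by (simp add: y append_cols_mult_append_rows[OF c z])
  show "y * four_block_mat (0\<^sub>m (n * m3) k) (0\<^sub>m (n * m3) k) K J = 0\<^sub>m m3 (k + k)"
    if "K \<in> carrier_mat (n * m3) k" "J \<in> carrier_mat (n * m3) k"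
    using that c unfolding y
    by (subst append_cols_mult_four_block[OF c z]) auto
qed

lemma carrier_Pi [simp, intro]:
  "Pi1 m1 m2 m3 t \<in> carrier_mat (m1 * (m2 * m3)) (m2 * m3 + m2 * m3)"
  "Pi2 m1 m2 m3 t \<in> carrier_mat (m1 * (m2 * m3)) (m1 * m3 + m1 * m3)"
  "Pi1_hat m1 m2 m3 t \<in> carrier_mat (m2 * m3 + m2 * m3) (m1 * (m2 * m3))"
  "Pi2_hat m1 m2 m3 t \<in> carrier_mat (m1 * m3 + m1 * m3) (m1 * (m2 * m3))"
  by (auto simp: Pi1_def Pi2_def Pi1_hat_def Pi2_hat_def)

lemma adj_shift_eq:
  "X \<in> carrier_mat n n \<Longrightarrow> adj_shift X \<mu> = mat_adjoint X - \<mu> \<cdot>\<^sub>m 1\<^sub>m n"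
  by (simp add: adj_shift_def)

lemma shifted_displacement_Pi1:
  "(A1 m1 m2 m3 - \<mu> \<cdot>\<^sub>m 1\<^sub>m (m1 * (m2 * m3))) * block_TBT m1 m2 m3 t
      - block_TBT m1 m2 m3 t * adj_shift (A1 m1 m2 m3) \<mu>
    = \<i> \<cdot>\<^sub>m (Pi1 m1 m2 m3 t * Pi1_hat m1 m2 m3 t)"
  unfolding Pi1_def Pi1_hat_def adj_shift_eq[OF carrier_block_matrices(2)]
  by (simp add: shift_commutator[OF carrier_block_matrices(2) carrier_mat_adjoint[OF carrier_block_matrices(2)]
      carrier_block_matrices(1)] displacement_T_1
      append_cols_mult_append_rows[of _ "m1 * (m2 * m3)" "m2 * m3" _ "m2 * m3" _ "m1 * (m2 * m3)"])

lemma shifted_displacement_Pi2: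
  "(A2 m1 m2 m3 - \<mu> \<cdot>\<^sub>m 1\<^sub>m (m1 * (m2 * m3))) * block_TBT m1 m2 m3 t
      - block_TBT m1 m2 m3 t * adj_shift (A2 m1 m2 m3) \<mu>
    = \<i> \<cdot>\<^sub>m (Pi2 m1 m2 m3 t * Pi2_hat m1 m2 m3 t)"
  unfolding Pi2_def Pi2_hat_def adj_shift_eq[OF carrier_block_matrices(3)]
  by (simp add: shift_commutator[OF carrier_block_matrices(3) carrier_mat_adjoint[OF carrier_block_matrices(3)]
      carrier_block_matrices(1)] displacement_T_2
      append_cols_mult_append_rows[of _ "m1 * (m2 * m3)" "m1 * m3" _ "m1 * m3" _ "m1 * (m2 * m3)"])

lemma adj_shift_calA_kron:
  "adj_shift (calA n) \<mu> \<otimes>\<^sub>K 1\<^sub>m r = (mat_adjoint (calA n) \<otimes>\<^sub>K 1\<^sub>m r) - \<mu> \<cdot>\<^sub>m 1\<^sub>m (n * r)"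
  by (simp add: adj_shift_eq[OF carrier_calA] kron_minus_left[of _ n n _ _ r r]
    kron_smult_left[of _ n n _ r r] kron_one_one)

lemma commutator_A2_Pi1:
  "(A2 m1 m2 m3 - \<mu> \<cdot>\<^sub>m 1\<^sub>m (m1 * (m2 * m3))) * Pi1 m1 m2 m3 t - Pi1 m1 m2 m3 t * E_diag m2 m3 \<mu>
    = \<i> \<cdot>\<^sub>m (Pi2 m1 m2 m3 t * four_block_mat (0\<^sub>m (m1 * m3) (m2 * m3)) (0\<^sub>m (m1 * m3) (m2 * m3))
          (K11 m1 m2 m3 t) (calL m1 m3 * mat_adjoint (calL m2 m3))
        + Nmat m1 m2 m3 t * (mat_adjoint (calL m2 m3) @\<^sub>c 0\<^sub>m m3 (m2 * m3)))"
proof -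
  have B: "mat_adjoint (calA m2) \<otimes>\<^sub>K 1\<^sub>m m3 \<in> carrier_mat (m2 * m3) (m2 * m3)" by auto
  note sc = shift_commutator[OF carrier_block_matrices(3) B]
  show ?thesis
    unfolding Pi1_def Pi2_def E_diag_def adj_shift_calA_kron
    by (rule append_cols_commutator)
      (auto simp: sc displacement_M11 displacement_M31 intro!: minus_carrier_mat)
qed

lemma commutator_A1_Pi2:
  "(A1 m1 m2 m3 - \<mu> \<cdot>\<^sub>m 1\<^sub>m (m1 * (m2 * m3))) * Pi2 m1 m2 m3 t - Pi2 m1 m2 m3 t * E_diag m1 m3 \<mu>
    = \<i> \<cdot>\<^sub>m (Pi1 m1 m2 m3 t * four_block_mat (0\<^sub>m (m2 * m3) (m1 * m3)) (0\<^sub>m (m2 * m3) (m1 * m3))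
          (K12 m1 m2 m3 t) (calL m2 m3 * mat_adjoint (calL m1 m3))
        + Nmat m1 m2 m3 t * (mat_adjoint (calL m1 m3) @\<^sub>c 0\<^sub>m m3 (m1 * m3)))"
proof -
  have B: "mat_adjoint (calA m1) \<otimes>\<^sub>K 1\<^sub>m m3 \<in> carrier_mat (m1 * m3) (m1 * m3)" by auto
  note sc = shift_commutator[OF carrier_block_matrices(2) B]
  show ?thesis
    unfolding Pi1_def Pi2_def E_diag_def adj_shift_calA_kron
    by (rule append_cols_commutator)
      (auto simp: sc displacement_M12 displacement_M32 intro!: minus_carrier_mat)
qed

lemma carrier_E_diag [simp, intro]: "E_diag n m3 \<mu> \<in> carrier_mat (n * m3 + n * m3) (n * m3 + n * m3)"
  unfolding E_diag_def by (rule four_block_carrier_mat) auto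

text \<open>The dimensions of a difference of matrices are those of the subtrahend, here an explicit block
matrix.\<close>

lemma carrier_E12: "E12 m1 m2 m3 t \<in> carrier_mat (m2 * m3 + m2 * m3) (m1 * m3 + m1 * m3)"
  unfolding E12_def
  by (intro minus_carrier_mat smult_carrier_mat four_block_carrier_mat zero_carrier_mat)
    auto

lemma carrier_E21: "E21 m1 m2 m3 t \<in> carrier_mat (m1 * m3 + m1 * m3) (m2 * m3 + m2 * m3)"
  unfolding E21_def
  by (intro minus_carrier_mat smult_carrier_mat four_block_carrier_mat zero_carrier_mat)
    auto

lemma carrier_E_fun:
  "E_fun m1 m2 m3 t \<mu>1 \<mu>2 \<in> carrier_mat ((m2 * m3 + m2 * m3) + (m1 * m3 + m1 * m3))
    ((m2 * m3 + m2 * m3) + (m1 * m3 + m1 * m3))"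
  unfolding E_fun_def by (intro four_block_carrier_mat carrier_E_diag carrier_E12 carrier_E21)

context
  fixes m1 m2 m3 :: nat and t :: "int \<Rightarrow> int \<Rightarrow> complex mat" and \<mu>1 \<mu>2 :: complex
  assumes inv: "invertible_mat (block_TBT m1 m2 m3 t)"
    and \<mu>: "\<mu>1 \<noteq> - \<i> / 2" "\<mu>2 \<noteq> - \<i> / 2"
begin

lemma carrier_Rinv: "Rinv m1 m2 m3 t \<in> carrier_mat (m1 * (m2 * m3)) (m1 * (m2 * m3))"
  and Rinv_left: "Rinv m1 m2 m3 t * block_TBT m1 m2 m3 t = 1\<^sub>m (m1 * (m2 * m3))"
  and Rinv_right: "block_TBT m1 m2 m3 t * Rinv m1 m2 m3 t = 1\<^sub>m (m1 * (m2 * m3))"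
  unfolding Rinv_def using minv_invertible[OF carrier_block_matrices(1) inv] by auto

lemma theta_fun_eq:
  "theta_fun m1 m2 m3 t \<mu>1 \<mu>2 = (- \<i>) \<cdot>\<^sub>m (1\<^sub>m m3
    + mat_adjoint (calL (m1 * m2) m3) * resolvent_prod m1 m2 m3 \<mu>1 \<mu>2
      * (Rinv m1 m2 m3 t * Nmat m1 m2 m3 t))"
  unfolding theta_fun_def
  using assoc_mult_mat[OF calL_resolvent_prod(1)[OF \<mu>] carrier_Rinv carrier_block_matrices(14)] by simp

lemma carrier_theta_fun: "theta_fun m1 m2 m3 t \<mu>1 \<mu>2 \<in> carrier_mat m3 m3"
  unfolding theta_fun_eq
  using mult_carrier_mat[OF calL_resolvent_prod(1)[OF \<mu>] mult_carrier_mat[OF carrier_Rinv carrier_block_matrices(14)]]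
  by auto

lemma carrier_u1: "u1 m1 m2 m3 t \<mu>1 \<mu>2 \<in> carrier_mat m3 (m2 * m3 + m2 * m3)"
  unfolding u1_def v1_def u_corr_def Gamma1_def
  by (intro minus_carrier_mat smult_carrier_mat u_corr_factor(1)[OF \<mu>(2)])

lemma carrier_u2: "u2 m1 m2 m3 t \<mu>1 \<mu>2 \<in> carrier_mat m3 (m1 * m3 + m1 * m3)"
  unfolding u2_def v2_def u_corr_def Gamma2_def
  by (intro minus_carrier_mat smult_carrier_mat u_corr_factor(1)[OF \<mu>(1)])

lemma u_mult_first_column:
  "u1 m1 m2 m3 t \<mu>1 \<mu>2 * E_diag m2 m3 \<mu>2 + u2 m1 m2 m3 t \<mu>1 \<mu>2 * E21 m1 m2 m3 t
    = theta_fun m1 m2 m3 t \<mu>1 \<mu>2 * (mat_adjoint (calL m2 m3) @\<^sub>c 0\<^sub>m m3 (m2 * m3))"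
  unfolding u1_def u2_def v1_def v2_def E21_def theta_fun_eq u_corr_def Gamma1_def Gamma2_def
  by (rule resolvent_coupling[OF carrier_block_matrices(1) carrier_Rinv Rinv_left Rinv_right _ _
        carrier_Pi(1) carrier_Pi(2) carrier_Pi(4) carrier_E_diag _ carrier_block_matrices(14) _
        calL_resolvent_prod(1)[OF \<mu>] u_corr_factor(1)[OF \<mu>(1)] u_corr_factor(1)[OF \<mu>(2)]
        shifted_displacement_Pi2 commutator_A2_Pi1])
    (auto simp: u_corr_factor(2)[OF \<mu>(2)] Pi2_hat_def u_corr_factor(3)[OF \<mu>(1) carrier_block_matrices(9,11)]
      u_corr_factor(4)[OF \<mu>(1) carrier_block_matrices(12)
        mult_carrier_mat[OF carrier_calL carrier_mat_adjoint[OF carrier_calL]]] calL_resolvent_prod(2)[OF \<mu>] 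
      intro!: minus_carrier_mat four_block_carrier_mat)

lemma u_mult_second_column:
  "u1 m1 m2 m3 t \<mu>1 \<mu>2 * E12 m1 m2 m3 t + u2 m1 m2 m3 t \<mu>1 \<mu>2 * E_diag m1 m3 \<mu>1
    = theta_fun m1 m2 m3 t \<mu>1 \<mu>2 * (mat_adjoint (calL m1 m3) @\<^sub>c 0\<^sub>m m3 (m1 * m3))"
proof -
  have "u2 m1 m2 m3 t \<mu>1 \<mu>2 * E_diag m1 m3 \<mu>1 + u1 m1 m2 m3 t \<mu>1 \<mu>2 * E12 m1 m2 m3 t
    = theta_fun m1 m2 m3 t \<mu>1 \<mu>2 * (mat_adjoint (calL m1 m3) @\<^sub>c 0\<^sub>m m3 (m1 * m3))"
    unfolding u1_def u2_def v1_def v2_def E12_def theta_fun_eq u_corr_def Gamma1_def Gamma2_def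
    by (rule resolvent_coupling[OF carrier_block_matrices(1) carrier_Rinv Rinv_left Rinv_right _ _
        carrier_Pi(2) carrier_Pi(1) carrier_Pi(3) carrier_E_diag _ carrier_block_matrices(14) _
        calL_resolvent_prod(1)[OF \<mu>] u_corr_factor(1)[OF \<mu>(2)] u_corr_factor(1)[OF \<mu>(1)]
        shifted_displacement_Pi1 commutator_A1_Pi2])
    (auto simp: u_corr_factor(2)[OF \<mu>(1)] Pi1_hat_def u_corr_factor(3)[OF \<mu>(2) carrier_block_matrices(5,7)]
      u_corr_factor(4)[OF \<mu>(2) carrier_block_matrices(13)
        mult_carrier_mat[OF carrier_calL carrier_mat_adjoint[OF carrier_calL]]] calL_resolvent_prod(3)[OF \<mu>] 
      intro!: minus_carrier_mat four_block_carrier_mat)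
  moreover have "u1 m1 m2 m3 t \<mu>1 \<mu>2 * E12 m1 m2 m3 t + u2 m1 m2 m3 t \<mu>1 \<mu>2 * E_diag m1 m3 \<mu>1
    = u2 m1 m2 m3 t \<mu>1 \<mu>2 * E_diag m1 m3 \<mu>1 + u1 m1 m2 m3 t \<mu>1 \<mu>2 * E12 m1 m2 m3 t"
    by (rule comm_add_mat[OF mult_carrier_mat[OF carrier_u1 carrier_E12]
        mult_carrier_mat[OF carrier_u2 carrier_E_diag]])
  ultimately show ?thesis by simp
qed

lemma u_fun_mult_E_fun:
  "u_fun m1 m2 m3 t \<mu>1 \<mu>2 * E_fun m1 m2 m3 t \<mu>1 \<mu>2 = theta_fun m1 m2 m3 t \<mu>1 \<mu>2
    * (mat_adjoint (calL m2 m3) @\<^sub>c 0\<^sub>m m3 (m2 * m3)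
        @\<^sub>c mat_adjoint (calL m1 m3) @\<^sub>c 0\<^sub>m m3 (m1 * m3))"
proof -
  let ?Z1 = "mat_adjoint (calL m2 m3) @\<^sub>c 0\<^sub>m m3 (m2 * m3)"
    and ?Z2 = "mat_adjoint (calL m1 m3) @\<^sub>c 0\<^sub>m m3 (m1 * m3)"
  have Z1: "?Z1 \<in> carrier_mat m3 (m2 * m3 + m2 * m3)" and Z2: "?Z2 \<in> carrier_mat m3 (m1 * m3 + m1 * m3)"
    by auto
  have "u_fun m1 m2 m3 t \<mu>1 \<mu>2 * E_fun m1 m2 m3 t \<mu>1 \<mu>2
    = (theta_fun m1 m2 m3 t \<mu>1 \<mu>2 * ?Z1) @\<^sub>c (theta_fun m1 m2 m3 t \<mu>1 \<mu>2 * ?Z2)"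
    unfolding u_fun_def E_fun_def append_cols_mult_four_block[OF carrier_u1 carrier_u2 carrier_E_diag
        carrier_E12 carrier_E21 carrier_E_diag]
    by (simp only: u_mult_first_column u_mult_second_column)
  also have "\<dots> = theta_fun m1 m2 m3 t \<mu>1 \<mu>2 * (?Z1 @\<^sub>c ?Z2)"
    by (rule mult_append_cols[OF carrier_theta_fun Z1 Z2, symmetric])
  also have "?Z1 @\<^sub>c ?Z2 = mat_adjoint (calL m2 m3) @\<^sub>c 0\<^sub>m m3 (m2 * m3) @\<^sub>c ?Z2"
    by (rule append_cols_assoc[OF _ _ Z2]) auto
  finally show ?thesis .
qed

end

theorem theorem3p4:
  fixes m1 m2 m3 :: nat
    and t :: "int \<Rightarrow> int \<Rightarrow> complex mat"
    and \<mu>1 \<mu>2 :: complex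
  assumes "m1 \<ge> 2" and "m2 \<ge> 2" and "m3 \<ge> 2"
    and "\<And>r s. \<bar>r\<bar> < int m1 \<Longrightarrow> \<bar>s\<bar> < int m2 \<Longrightarrow> t r s \<in> carrier_mat m3 m3"
    and "invertible_mat (block_TBT m1 m2 m3 t)"
    and "\<mu>1 \<noteq> - \<i> / 2" and "\<mu>2 \<noteq> - \<i> / 2"
    and "det (E_fun m1 m2 m3 t \<mu>1 \<mu>2) \<noteq> 0"
  shows "u_fun m1 m2 m3 t \<mu>1 \<mu>2 =
    theta_fun m1 m2 m3 t \<mu>1 \<mu>2
      * (mat_adjoint (calL m2 m3) @\<^sub>c 0\<^sub>m m3 (m2 * m3)
          @\<^sub>c mat_adjoint (calL m1 m3) @\<^sub>c 0\<^sub>m m3 (m1 * m3))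
      * minv (E_fun m1 m2 m3 t \<mu>1 \<mu>2)"
proof -
  note h = assms(5-7)
  let ?u = "u_fun m1 m2 m3 t \<mu>1 \<mu>2" and ?E = "E_fun m1 m2 m3 t \<mu>1 \<mu>2"
  note E = carrier_E_fun[of m1 m2 m3 t \<mu>1 \<mu>2]
  note i = minv_det_nonzero[OF E assms(8)]
  have u: "?u \<in> carrier_mat m3 ((m2 * m3 + m2 * m3) + (m1 * m3 + m1 * m3))"
    unfolding u_fun_def by (intro carrier_append_cols carrier_u1[OF h] carrier_u2[OF h])
  have "?u = ?u * (?E * minv ?E)" using u i by simp
  also have "\<dots> = ?u * ?E * minv ?E" using assoc_mult_mat[OF u E i(1)] by simp
  finally show ?thesis unfolding u_fun_mult_E_fun[OF h] .
qed

end
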